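(* Let $(\omega_1,\omega_2,\omega_3)$ be an $\boldsymbol\varepsilon$-hypersymplectic structure on a Lie algebroid $(A,\rho,[\cdot,\cdot])$, with inverse Poisson bivectors $\pi_1,\pi_2,\pi_3$. For all $i\in\mathbb{Z}_3$: (a) $(\pi_{i+1},\omega_i)$ is a $P\Omega$ structure on $A$; (b) $(\pi_{i-1},\omega_i)$ is a $P\Omega$ structure on $A$.
   Context: Let $\mathrm d$ denote the differential of the Lie algebroid. For a $2$-form $\omega\in\Gamma(\bigwedge^2A^* )$, $\langle\omega^\flat(X),Y\rangle=\omega(X,Y)$; for a bivector $\pi\in\Gamma(\bigwedge^2A)$, $\langle\beta,\pi^\sharp(\alpha)\rangle=\pi(\alpha,\beta)$. A symplectic form is a closed non-degenerate $2$-form; its inverse Poisson bivector $\pi$ satisfies $\omega^\flat\circ\pi^\sharp=\mathrm{Id}_{A^*}$, $\pi^\sharp\circ\omega^\flat=\mathrm{Id}_A$. All indices are in $\mathbb{Z}_3=\{1,2,3\}$. Given symplectic forms $\omega_1,\omega_2,\omega_3$ with inverses $\pi_1,\pi_2,\pi_3$, the transition tensors are $N_i:=\pi_{i-1}^\sharp\circ\omega_{i+1}^\flat$. The triple is an $\boldsymbol\varepsilon$-hypersymplectic structure, $\boldsymbol\varepsilon=(\varepsilon_1,\varepsilon_2,\varepsilon_3)$ with $\varepsilon_i=\pm1$, if $N_i^2=\varepsilon_i\mathrm{Id}_A$ for $i=1,2,3$. A pair $(\pi,\omega)$ of a bivector and a $2$-form on $A$ is a $P\Omega$ structure if $[\pi,\pi]=0$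 (Schouten–Nijenhuis bracket), $\mathrm d\omega=0$ and $\mathrm d(\omega_N)=0$, where $N=\pi^\sharp\circ\omega^\flat$ and $\omega_N(X,Y)=\omega(NX,Y)$, i.e. $\omega_N^\flat=\omega^\flat\circ N$. *)

theory Defs
  imports "HOL-Analysis.Analysis"
begin

section \<open>Smooth functions on open subsets of coordinate space\<close>

text \<open>
  Coordinate space is the library's \<^const>\<open>Euclidean_space\<close> \<open>n\<close>, carried by the
  sequences \<open>x\<close> with \<open>x i = 0\<close> for \<open>i \<ge> n\<close>; this keeps the dimension a natural
  number, with \<open>n = 0\<close> allowed. On an open set \<open>S\<close> of it, \<open>Ck k n S f\<close> says that all
  iterated partial derivatives of \<open>f\<close> of order at most \<open>k\<close> exist and are continuous on \<open>S\<close>.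
\<close>

primrec Ck :: "nat \<Rightarrow> nat \<Rightarrow> (nat \<Rightarrow> real) set \<Rightarrow> ((nat \<Rightarrow> real) \<Rightarrow> real) \<Rightarrow> bool" where
  "Ck 0 n S f = continuous_on S f"
| "Ck (Suc k) n S f =
    (continuous_on S f \<and>
     (\<forall>i<n. \<exists>g. (\<forall>y\<in>S. ((\<lambda>t. f (y(i := t))) has_real_derivative g y) (at (y i))) \<and> Ck k n S g))"

definition Csmooth :: "nat \<Rightarrow> (nat \<Rightarrow> real) set \<Rightarrow> ((nat \<Rightarrow> real) \<Rightarrow> real) \<Rightarrow> bool" where
  "Csmooth n S f \<longleftrightarrow> (\<forall>k. Ck k n S f)"


section \<open>Smooth manifolds and vector bundles\<close>

text \<open>
  The base manifold is the whole type \<open>'m\<close>. The fibre over \<open>x\<close> is a subspace \<open>fibre E x\<close> of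
  an auxiliary real vector space \<open>'v\<close>, which carries no topology: fibres over different points
  are unrelated, the total space is the disjoint union of the fibres, and the smooth structure
  of the bundle is given by the local frames alone. The anchor is a bundle map into the tangent
  bundle, tangent vectors at \<open>x\<close> being derivations at \<open>x\<close> of the algebra of smooth functions.
\<close>

record ('m, 'v) algebroid =
  dim_base :: nat
  atlas :: "('m set \<times> ('m \<Rightarrow> nat \<Rightarrow> real)) set"
  rank_bundle :: nat
  fibre :: "'m \<Rightarrow> 'v set"
  frames :: "('m set \<times> (nat \<Rightarrow> 'm \<Rightarrow> 'v)) set"
  anchor :: "'m \<Rightarrow> 'v \<Rightarrow> ('m \<Rightarrow> real) \<Rightarrow> real"
  bracket :: "('m \<Rightarrow> 'v) \<Rightarrow> ('m \<Rightarrow> 'v) \<Rightarrow> 'm \<Rightarrow> 'v"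

definition smooth_manifold ::
  "('m :: {t2_space, second_countable_topology}, 'v, 'z) algebroid_scheme \<Rightarrow> bool" where
  "smooth_manifold E \<longleftrightarrow>
    (\<Union>(U, \<phi>)\<in>atlas E. U) = UNIV \<and>
    (\<forall>(U, \<phi>)\<in>atlas E. open U \<and> openin (Euclidean_space (dim_base E)) (\<phi> ` U) \<and>
       homeomorphism U (\<phi> ` U) \<phi> (inv_into U \<phi>)) \<and>
    (\<forall>(U, \<phi>)\<in>atlas E. \<forall>(V, \<psi>)\<in>atlas E. \<forall>i<dim_base E.
       Csmooth (dim_base E) (\<phi> ` (U \<inter> V)) (\<lambda>y. \<psi> (inv_into U \<phi> y) i))"

definition smooth_fun_on ::
  "('m :: topological_space, 'v, 'z) algebroid_scheme \<Rightarrow> 'm set \<Rightarrow> ('m \<Rightarrow> real) \<Rightarrow> bool" where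
  "smooth_fun_on E W f \<longleftrightarrow>
    (\<forall>(U, \<phi>)\<in>atlas E. Csmooth (dim_base E) (\<phi> ` (U \<inter> W)) (f \<circ> inv_into U \<phi>))"

abbreviation smooth_fun ::
  "('m :: topological_space, 'v, 'z) algebroid_scheme \<Rightarrow> ('m \<Rightarrow> real) \<Rightarrow> bool" where
  "smooth_fun E \<equiv> smooth_fun_on E UNIV"

text \<open>
  \<open>coframe E e x a\<close> is the \<open>a\<close>-th member of the basis of the dual fibre at \<open>x\<close> dual to
  the frame \<open>e\<close>. Like \<^const>\<open>representation\<close>, it vanishes outside the fibre.
\<close>

definition coframe ::
  "('m, 'v :: real_vector, 'z) algebroid_scheme \<Rightarrow> (nat \<Rightarrow> 'm \<Rightarrow> 'v) \<Rightarrow> 'm \<Rightarrow> nat \<Rightarrow> 'v \<Rightarrow> real" where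
  "coframe E e x a = (\<lambda>v. representation ((\<lambda>b. e b x) ` {..<rank_bundle E}) v (e a x))"

definition vector_bundle ::
  "('m :: {t2_space, second_countable_topology}, 'v :: real_vector, 'z) algebroid_scheme \<Rightarrow> bool" where
  "vector_bundle E \<longleftrightarrow>
    smooth_manifold E \<and>
    (\<forall>x. subspace (fibre E x)) \<and>
    (\<Union>(U, e)\<in>frames E. U) = UNIV \<and>
    (\<forall>(U, e)\<in>frames E. open U \<and>
       (\<forall>x\<in>U. inj_on (\<lambda>a. e a x) {..<rank_bundle E} \<and>
              independent ((\<lambda>a. e a x) ` {..<rank_bundle E}) \<and>
              span ((\<lambda>a. e a x) ` {..<rank_bundle E}) = fibre E x)) \<and>
    (\<forall>(U, e)\<in>frames E. \<forall>(V, f)\<in>frames E. \<forall>a<rank_bundle E. \<forall>b<rank_bundle E.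
       smooth_fun_on E (U \<inter> V) (\<lambda>x. coframe E e x a (f b x)))"

definition is_section ::
  "('m :: topological_space, 'v :: real_vector, 'z) algebroid_scheme \<Rightarrow> ('m \<Rightarrow> 'v) \<Rightarrow> bool" where
  "is_section E X \<longleftrightarrow>
    (\<forall>x. X x \<in> fibre E x) \<and>
    (\<forall>(U, e)\<in>frames E. \<forall>a<rank_bundle E. smooth_fun_on E U (\<lambda>x. coframe E e x a (X x)))"


section \<open>Lie algebroids\<close>

definition lie_algebroid ::
  "('m :: {t2_space, second_countable_topology}, 'v :: real_vector, 'z) algebroid_scheme \<Rightarrow> bool" where
  "lie_algebroid E \<longleftrightarrow>
    vector_bundle E \<and>
    \<comment> \<open>the anchor is a smooth bundle map to the tangent bundle\<close>
    (\<forall>x. \<forall>v\<in>fibre E x. \<forall>f g. smooth_fun E f \<longrightarrow> smooth_fun E g \<longrightarrow>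
       anchor E x v (\<lambda>y. f y + g y) = anchor E x v f + anchor E x v g \<and>
       (\<forall>c. anchor E x v (\<lambda>y. c * f y) = c * anchor E x v f) \<and>
       anchor E x v (\<lambda>y. f y * g y) = anchor E x v f * g x + f x * anchor E x v g) \<and>
    (\<forall>x. \<forall>u\<in>fibre E x. \<forall>v\<in>fibre E x. \<forall>c f. smooth_fun E f \<longrightarrow>
       anchor E x (u + v) f = anchor E x u f + anchor E x v f \<and>
       anchor E x (c *\<^sub>R u) f = c * anchor E x u f) \<and>
    (\<forall>X f. is_section E X \<longrightarrow> smooth_fun E f \<longrightarrow> smooth_fun E (\<lambda>x. anchor E x (X x) f)) \<and>
    \<comment> \<open>the bracket is a real Lie algebra structure on the space of sections\<close>
    (\<forall>X Y. is_section E X \<longrightarrow> is_section E Y \<longrightarrow> is_section E (bracket E X Y)) \<and>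
    (\<forall>X Y Z. is_section E X \<longrightarrow> is_section E Y \<longrightarrow> is_section E Z \<longrightarrow>
       (\<forall>x. bracket E (\<lambda>y. X y + Y y) Z x = bracket E X Z x + bracket E Y Z x)) \<and>
    (\<forall>X Y c. is_section E X \<longrightarrow> is_section E Y \<longrightarrow>
       (\<forall>x. bracket E (\<lambda>y. c *\<^sub>R X y) Y x = c *\<^sub>R bracket E X Y x)) \<and>
    (\<forall>X Y. is_section E X \<longrightarrow> is_section E Y \<longrightarrow>
       (\<forall>x. bracket E X Y x = - bracket E Y X x)) \<and>
    (\<forall>X Y Z. is_section E X \<longrightarrow> is_section E Y \<longrightarrow> is_section E Z \<longrightarrow>
       (\<forall>x. bracket E X (bracket E Y Z) x + bracket E Y (bracket E Z X) x +
            bracket E Z (bracket E X Y) x = 0)) \<and>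
    \<comment> \<open>Leibniz rule\<close>
    (\<forall>X Y f. is_section E X \<longrightarrow> is_section E Y \<longrightarrow> smooth_fun E f \<longrightarrow>
       (\<forall>x. bracket E X (\<lambda>y. f y *\<^sub>R Y y) x =
            f x *\<^sub>R bracket E X Y x + anchor E x (X x) f *\<^sub>R Y x))"


section \<open>Forms and bivectors\<close>

text \<open>Covectors at \<open>x\<close> are extended by zero outside the fibre, so that equality of covectors
  is equality of functions.\<close>

definition dual_fibre ::
  "('m, 'v :: real_vector, 'z) algebroid_scheme \<Rightarrow> 'm \<Rightarrow> ('v \<Rightarrow> real) set" where
  "dual_fibre E x = {\<alpha>.
     (\<forall>u\<in>fibre E x. \<forall>v\<in>fibre E x. \<alpha> (u + v) = \<alpha> u + \<alpha> v) \<and>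
     (\<forall>u\<in>fibre E x. \<forall>c. \<alpha> (c *\<^sub>R u) = c * \<alpha> u) \<and>
     (\<forall>u. u \<notin> fibre E x \<longrightarrow> \<alpha> u = 0)}"

definition one_form ::
  "('m :: topological_space, 'v :: real_vector, 'z) algebroid_scheme \<Rightarrow> ('m \<Rightarrow> 'v \<Rightarrow> real) \<Rightarrow> bool" where
  "one_form E \<alpha> \<longleftrightarrow>
    (\<forall>x. \<alpha> x \<in> dual_fibre E x) \<and>
    (\<forall>(U, e)\<in>frames E. \<forall>a<rank_bundle E. smooth_fun_on E U (\<lambda>x. \<alpha> x (e a x)))"

definition two_form ::
  "('m :: topological_space, 'v :: real_vector, 'z) algebroid_scheme \<Rightarrow>
   ('m \<Rightarrow> 'v \<Rightarrow> 'v \<Rightarrow> real) \<Rightarrow> bool" where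
  "two_form E \<omega> \<longleftrightarrow>
    (\<forall>x. \<forall>u\<in>fibre E x. \<forall>v\<in>fibre E x. \<forall>w\<in>fibre E x. \<forall>c.
       \<omega> x (u + v) w = \<omega> x u w + \<omega> x v w \<and>
       \<omega> x (c *\<^sub>R u) w = c * \<omega> x u w \<and>
       \<omega> x u w = - \<omega> x w u) \<and>
    (\<forall>(U, e)\<in>frames E. \<forall>a<rank_bundle E. \<forall>b<rank_bundle E.
       smooth_fun_on E U (\<lambda>x. \<omega> x (e a x) (e b x)))"

text \<open>A bivector field is a smooth field of alternating bilinear forms on the dual fibres.\<close>

definition bivector ::
  "('m :: topological_space, 'v :: real_vector, 'z) algebroid_scheme \<Rightarrow>
   ('m \<Rightarrow> ('v \<Rightarrow> real) \<Rightarrow> ('v \<Rightarrow> real) \<Rightarrow> real) \<Rightarrow> bool" where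
  "bivector E \<pi> \<longleftrightarrow>
    (\<forall>x. \<forall>\<alpha>\<in>dual_fibre E x. \<forall>\<beta>\<in>dual_fibre E x. \<forall>\<gamma>\<in>dual_fibre E x. \<forall>c.
       \<pi> x (\<lambda>v. \<alpha> v + \<beta> v) \<gamma> = \<pi> x \<alpha> \<gamma> + \<pi> x \<beta> \<gamma> \<and>
       \<pi> x (\<lambda>v. c * \<alpha> v) \<gamma> = c * \<pi> x \<alpha> \<gamma> \<and>
       \<pi> x \<alpha> \<gamma> = - \<pi> x \<gamma> \<alpha>) \<and>
    (\<forall>(U, e)\<in>frames E. \<forall>a<rank_bundle E. \<forall>b<rank_bundle E.
       smooth_fun_on E U (\<lambda>x. \<pi> x (coframe E e x a) (coframe E e x b)))"

definition flat ::
  "('m, 'v :: real_vector, 'z) algebroid_scheme \<Rightarrow> ('m \<Rightarrow> 'v \<Rightarrow> 'v \<Rightarrow> real) \<Rightarrow> 'm \<Rightarrow> 'v \<Rightarrow> 'v \<Rightarrow> real" where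
  "flat E \<omega> x u = (\<lambda>v. if v \<in> fibre E x then \<omega> x u v else 0)"

definition sharp ::
  "('m, 'v :: real_vector, 'z) algebroid_scheme \<Rightarrow> ('m \<Rightarrow> ('v \<Rightarrow> real) \<Rightarrow> ('v \<Rightarrow> real) \<Rightarrow> real) \<Rightarrow>
   'm \<Rightarrow> ('v \<Rightarrow> real) \<Rightarrow> 'v" where
  "sharp E \<pi> x \<alpha> = (THE u. u \<in> fibre E x \<and> (\<forall>\<beta>\<in>dual_fibre E x. \<beta> u = \<pi> x \<alpha> \<beta>))"

text \<open>The differential of the Lie algebroid in degrees one and two.\<close>

definition d_one ::
  "('m, 'v, 'z) algebroid_scheme \<Rightarrow> ('m \<Rightarrow> 'v \<Rightarrow> real) \<Rightarrow>
   ('m \<Rightarrow> 'v) \<Rightarrow> ('m \<Rightarrow> 'v) \<Rightarrow> 'm \<Rightarrow> real" where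
  "d_one E \<alpha> X Y x =
    anchor E x (X x) (\<lambda>y. \<alpha> y (Y y)) - anchor E x (Y x) (\<lambda>y. \<alpha> y (X y)) - \<alpha> x (bracket E X Y x)"

definition d_two ::
  "('m, 'v, 'z) algebroid_scheme \<Rightarrow> ('m \<Rightarrow> 'v \<Rightarrow> 'v \<Rightarrow> real) \<Rightarrow>
   ('m \<Rightarrow> 'v) \<Rightarrow> ('m \<Rightarrow> 'v) \<Rightarrow> ('m \<Rightarrow> 'v) \<Rightarrow> 'm \<Rightarrow> real" where
  "d_two E \<omega> X Y Z x =
    anchor E x (X x) (\<lambda>y. \<omega> y (Y y) (Z y)) - anchor E x (Y x) (\<lambda>y. \<omega> y (X y) (Z y)) +
    anchor E x (Z x) (\<lambda>y. \<omega> y (X y) (Y y)) -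
    \<omega> x (bracket E X Y x) (Z x) + \<omega> x (bracket E X Z x) (Y x) - \<omega> x (bracket E Y Z x) (X x)"

definition closed_two_form ::
  "('m :: topological_space, 'v :: real_vector, 'z) algebroid_scheme \<Rightarrow>
   ('m \<Rightarrow> 'v \<Rightarrow> 'v \<Rightarrow> real) \<Rightarrow> bool" where
  "closed_two_form E \<omega> \<longleftrightarrow> two_form E \<omega> \<and>
    (\<forall>X Y Z x. is_section E X \<longrightarrow> is_section E Y \<longrightarrow> is_section E Z \<longrightarrow> d_two E \<omega> X Y Z x = 0)"

text \<open>
  The Schouten-Nijenhuis bracket of two bivector fields, as a trivector field evaluated on
  three one-forms. The formula is real bilinear in the two bivector fields, and on decomposable
  bivector fields it gives the usual expression
  \<open>[X \<and> Y, Z \<and> W] = [X,Z] \<and> Y \<and> W - [X,W] \<and> Y \<and> Z - [Y,Z] \<and> X \<and> W + [Y,W] \<and> X \<and> Z\<close>;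
  see \<open>schouten_commute\<close>, \<open>schouten_add_left\<close>, \<open>schouten_scale_left\<close> and
  \<open>schouten_decomposable\<close> at the end of this theory. Every bivector field is locally a sum of
  decomposable ones, so this determines the bracket.
\<close>

definition schouten ::
  "('m, 'v :: real_vector, 'z) algebroid_scheme \<Rightarrow>
   ('m \<Rightarrow> ('v \<Rightarrow> real) \<Rightarrow> ('v \<Rightarrow> real) \<Rightarrow> real) \<Rightarrow> ('m \<Rightarrow> ('v \<Rightarrow> real) \<Rightarrow> ('v \<Rightarrow> real) \<Rightarrow> real) \<Rightarrow>
   ('m \<Rightarrow> 'v \<Rightarrow> real) \<Rightarrow> ('m \<Rightarrow> 'v \<Rightarrow> real) \<Rightarrow> ('m \<Rightarrow> 'v \<Rightarrow> real) \<Rightarrow> 'm \<Rightarrow> real" where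
  "schouten E P Q \<alpha> \<beta> \<gamma> x =
    (let S = (\<lambda>R \<eta> y. sharp E R y (\<eta> y));
         T = (\<lambda>\<xi> \<eta> \<zeta>.
            anchor E x (S P \<xi> x) (\<lambda>y. Q y (\<eta> y) (\<zeta> y)) +
            anchor E x (S Q \<xi> x) (\<lambda>y. P y (\<eta> y) (\<zeta> y)) -
            d_one E \<xi> (S P \<eta>) (S Q \<zeta>) x - d_one E \<xi> (S Q \<eta>) (S P \<zeta>) x)
     in T \<alpha> \<beta> \<gamma> + T \<beta> \<gamma> \<alpha> + T \<gamma> \<alpha> \<beta>)"

definition poisson_bivector ::
  "('m :: topological_space, 'v :: real_vector, 'z) algebroid_scheme \<Rightarrow>
   ('m \<Rightarrow> ('v \<Rightarrow> real) \<Rightarrow> ('v \<Rightarrow> real) \<Rightarrow> real) \<Rightarrow> bool" where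
  "poisson_bivector E \<pi> \<longleftrightarrow> bivector E \<pi> \<and>
    (\<forall>\<alpha> \<beta> \<gamma> x. one_form E \<alpha> \<longrightarrow> one_form E \<beta> \<longrightarrow> one_form E \<gamma> \<longrightarrow> schouten E \<pi> \<pi> \<alpha> \<beta> \<gamma> x = 0)"


section \<open>Hypersymplectic and P-Omega structures\<close>

definition symplectic_form ::
  "('m :: topological_space, 'v :: real_vector, 'z) algebroid_scheme \<Rightarrow>
   ('m \<Rightarrow> 'v \<Rightarrow> 'v \<Rightarrow> real) \<Rightarrow> bool" where
  "symplectic_form E \<omega> \<longleftrightarrow> closed_two_form E \<omega> \<and>
    (\<forall>x. \<forall>u\<in>fibre E x. (\<forall>v\<in>fibre E x. \<omega> x u v = 0) \<longrightarrow> u = 0)"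

definition inverse_bivector ::
  "('m :: topological_space, 'v :: real_vector, 'z) algebroid_scheme \<Rightarrow>
   ('m \<Rightarrow> 'v \<Rightarrow> 'v \<Rightarrow> real) \<Rightarrow> ('m \<Rightarrow> ('v \<Rightarrow> real) \<Rightarrow> ('v \<Rightarrow> real) \<Rightarrow> real) \<Rightarrow> bool" where
  "inverse_bivector E \<omega> \<pi> \<longleftrightarrow> bivector E \<pi> \<and>
    (\<forall>x. (\<forall>\<alpha>\<in>dual_fibre E x. flat E \<omega> x (sharp E \<pi> x \<alpha>) = \<alpha>) \<and>
         (\<forall>u\<in>fibre E x. sharp E \<pi> x (flat E \<omega> x u) = u))"

text \<open>The composite \<open>\<pi>\<^sup>\<sharp> \<circ> \<omega>\<^sup>\<flat>\<close>.\<close>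

definition sharp_flat ::
  "('m, 'v :: real_vector, 'z) algebroid_scheme \<Rightarrow> ('m \<Rightarrow> ('v \<Rightarrow> real) \<Rightarrow> ('v \<Rightarrow> real) \<Rightarrow> real) \<Rightarrow>
   ('m \<Rightarrow> 'v \<Rightarrow> 'v \<Rightarrow> real) \<Rightarrow> 'm \<Rightarrow> 'v \<Rightarrow> 'v" where
  "sharp_flat E \<pi> \<omega> x u = sharp E \<pi> x (flat E \<omega> x u)"

text \<open>Indices live in the library's type \<^typ>\<open>3\<close> of integers modulo three, where the numeral
  \<open>3\<close> is \<open>0\<close>.\<close>

definition transition_tensor ::
  "('m, 'v :: real_vector, 'z) algebroid_scheme \<Rightarrow> (3 \<Rightarrow> 'm \<Rightarrow> 'v \<Rightarrow> 'v \<Rightarrow> real) \<Rightarrow>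
   (3 \<Rightarrow> 'm \<Rightarrow> ('v \<Rightarrow> real) \<Rightarrow> ('v \<Rightarrow> real) \<Rightarrow> real) \<Rightarrow> 3 \<Rightarrow> 'm \<Rightarrow> 'v \<Rightarrow> 'v" where
  "transition_tensor E \<omega> \<pi> i = sharp_flat E (\<pi> (i - 1)) (\<omega> (i + 1))"

definition hypersymplectic ::
  "('m :: topological_space, 'v :: real_vector, 'z) algebroid_scheme \<Rightarrow> (3 \<Rightarrow> real) \<Rightarrow>
   (3 \<Rightarrow> 'm \<Rightarrow> 'v \<Rightarrow> 'v \<Rightarrow> real) \<Rightarrow> (3 \<Rightarrow> 'm \<Rightarrow> ('v \<Rightarrow> real) \<Rightarrow> ('v \<Rightarrow> real) \<Rightarrow> real) \<Rightarrow> bool" where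
  "hypersymplectic E \<epsilon> \<omega> \<pi> \<longleftrightarrow>
    (\<forall>i. \<epsilon> i = 1 \<or> \<epsilon> i = -1) \<and>
    (\<forall>i. symplectic_form E (\<omega> i)) \<and>
    (\<forall>i. inverse_bivector E (\<omega> i) (\<pi> i)) \<and>
    (\<forall>i x. \<forall>u\<in>fibre E x.
       transition_tensor E \<omega> \<pi> i x (transition_tensor E \<omega> \<pi> i x u) = \<epsilon> i *\<^sub>R u)"

definition P_Omega ::
  "('m :: topological_space, 'v :: real_vector, 'z) algebroid_scheme \<Rightarrow>
   ('m \<Rightarrow> ('v \<Rightarrow> real) \<Rightarrow> ('v \<Rightarrow> real) \<Rightarrow> real) \<Rightarrow> ('m \<Rightarrow> 'v \<Rightarrow> 'v \<Rightarrow> real) \<Rightarrow> bool" where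
  "P_Omega E \<pi> \<omega> \<longleftrightarrow>
    poisson_bivector E \<pi> \<and> closed_two_form E \<omega> \<and>
    closed_two_form E (\<lambda>x u v. \<omega> x (sharp_flat E \<pi> \<omega> x u) v)"


section \<open>The Schouten-Nijenhuis bracket of decomposable bivector fields\<close>

subsection \<open>Smooth functions\<close>

lemma upd_in_open:
  assumes S: "openin (Euclidean_space n) S" and y: "y \<in> S" and i: "i < n"
  shows "\<forall>\<^sub>F t in nhds (y i). y(i := t) \<in> S"
proof -
  obtain W where W: "openin (powertop_real UNIV) W" "S = W \<inter> {x. \<forall>j\<ge>n. x j = 0}"
    using S unfolding Euclidean_space_def openin_subtopology by auto
  have oW: "open W" using W(1) by (simp add: open_fun_def)
  have c: "continuous_on UNIV (\<lambda>t. y(i := t))"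
  proof (rule continuous_on_coordinatewise_then_product)
    fix j show "continuous_on UNIV (\<lambda>t. (y(i := t)) j)"
      by (cases "j = i") (auto intro: continuous_intros)
  qed
  have "open ((\<lambda>t. y(i := t)) -` W)"
    using c oW by (simp add: continuous_on_open_vimage)
  moreover have "y i \<in> (\<lambda>t. y(i := t)) -` W" using y W by auto
  ultimately have "\<forall>\<^sub>F t in nhds (y i). t \<in> (\<lambda>t. y(i := t)) -` W"
    by (rule eventually_nhds_in_open)
  then show ?thesis
    by eventually_elim (use y W i in auto)
qed

lemma has_deriv_upd_cong:
  assumes S: "openin (Euclidean_space n) S" and y: "y \<in> S" and i: "i < n"
    and fg: "\<And>z. z \<in> S \<Longrightarrow> f z = g z"
  shows "((\<lambda>t. f (y(i := t))) has_real_derivative D) (at (y i)) \<longleftrightarrow>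
         ((\<lambda>t. g (y(i := t))) has_real_derivative D) (at (y i))"
  by (rule DERIV_cong_ev[OF refl _ refl])
     (use upd_in_open[OF S y i] fg in \<open>auto elim: eventually_mono\<close>)

lemma Ck_cong:
  assumes S: "openin (Euclidean_space n) S" and fg: "\<And>z. z \<in> S \<Longrightarrow> f z = g z"
    and "Ck k n S f"
  shows "Ck k n S g"
  using fg assms(3)
proof (induction k arbitrary: f g)
  case 0
  then show ?case by (metis Ck.simps(1) continuous_on_cong)
next
  case (Suc k)
  have 1: "continuous_on S g" using Suc.prems by (metis Ck.simps(2) continuous_on_cong)
  show ?case unfolding Ck.simps
  proof (intro conjI 1 allI impI)
    fix i assume i: "i < n"
    then obtain h where "\<forall>y\<in>S. ((\<lambda>t. f (y(i := t))) has_real_derivative h y) (at (y i))" "Ck k n S h"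
      using Suc.prems(2) by auto
    then show "\<exists>h. (\<forall>y\<in>S. ((\<lambda>t. g (y(i := t))) has_real_derivative h y) (at (y i))) \<and> Ck k n S h"
      using has_deriv_upd_cong[OF S _ i, of _ f g] Suc.prems(1) by (metis)
  qed
qed

lemma Ck_Suc_imp: "Ck (Suc k) n S f \<Longrightarrow> Ck k n S f"
proof (induction k arbitrary: f)
  case (Suc k)
  show ?case unfolding Ck.simps(2)[of k]
  proof (intro conjI allI impI)
    show "continuous_on S f" using Suc.prems by simp
    fix i assume "i < n"
    then obtain g where "\<forall>y\<in>S. ((\<lambda>t. f (y(i := t))) has_real_derivative g y) (at (y i))" "Ck (Suc k) n S g"
      using Suc.prems unfolding Ck.simps(2)[of "Suc k"] by blast
    with Suc.IH show "\<exists>g. (\<forall>y\<in>S. ((\<lambda>t. f (y(i := t))) has_real_derivative g y) (at (y i))) \<and> Ck k n S g"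
      by blast
  qed
qed auto

lemma Ck_const: "Ck k n S (\<lambda>_. c)"
proof (induction k arbitrary: c)
  case (Suc k)
  have "(\<forall>y\<in>S. ((\<lambda>t. c) has_real_derivative 0) (at (y i))) \<and> Ck k n S (\<lambda>_. 0)" for i
    using Suc.IH[of 0] by auto
  then show ?case by (simp, metis)
qed auto

lemma Ck_add: "Ck k n S f \<Longrightarrow> Ck k n S g \<Longrightarrow> Ck k n S (\<lambda>x. f x + g x)"
proof (induction k arbitrary: f g)
  case (Suc k)
  show ?case unfolding Ck.simps
  proof (intro conjI allI impI)
    show "continuous_on S (\<lambda>x. f x + g x)" using Suc.prems by (auto intro: continuous_on_add)
    fix i assume i: "i < n"
    obtain f' where D1:
      "\<forall>y\<in>S. ((\<lambda>t. f (y(i := t))) has_real_derivative f' y) (at (y i))" "Ck k n S f'"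
      using Suc.prems(1) i by auto
    obtain g' where D2:
      "\<forall>y\<in>S. ((\<lambda>t. g (y(i := t))) has_real_derivative g' y) (at (y i))" "Ck k n S g'"
      using Suc.prems(2) i by auto
    from D1 D2 show "\<exists>h. (\<forall>y\<in>S. ((\<lambda>t. f (y(i := t)) + g (y(i := t))) has_real_derivative h y) (at (y i))) \<and> Ck k n S h"
      using Suc.IH by (intro exI[of _ "\<lambda>x. f' x + g' x"]) (auto intro!: derivative_intros)
  qed
qed (auto intro: continuous_on_add)

lemma Ck_mult: "Ck k n S f \<Longrightarrow> Ck k n S g \<Longrightarrow> Ck k n S (\<lambda>x. f x * g x)"
proof (induction k arbitrary: f g)
  case (Suc k)
  show ?case unfolding Ck.simps
  proof (intro conjI allI impI)
    show "continuous_on S (\<lambda>x. f x * g x)" using Suc.prems by (auto intro: continuous_on_mult)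
    fix i assume i: "i < n"
    obtain f' where D1:
      "\<forall>y\<in>S. ((\<lambda>t. f (y(i := t))) has_real_derivative f' y) (at (y i))" "Ck k n S f'"
      using Suc.prems(1) i by auto
    obtain g' where D2:
      "\<forall>y\<in>S. ((\<lambda>t. g (y(i := t))) has_real_derivative g' y) (at (y i))" "Ck k n S g'"
      using Suc.prems(2) i by auto
    note D = D1 D2
    have "Ck k n S (\<lambda>x. f' x * g x + g' x * f x)"
      by (intro Ck_add Suc.IH D Ck_Suc_imp[OF Suc.prems(1)] Ck_Suc_imp[OF Suc.prems(2)])
    moreover have "((\<lambda>t. f (y(i := t)) * g (y(i := t))) has_real_derivative f' y * g y + g' y * f y) (at (y i))"
      if "y \<in> S" for y
      using DERIV_mult[OF D(1)[rule_format, OF that] D(3)[rule_format, OF that]] by simp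
    ultimately show "\<exists>h. (\<forall>y\<in>S. ((\<lambda>t. f (y(i := t)) * g (y(i := t))) has_real_derivative h y) (at (y i))) \<and> Ck k n S h"
      by (intro exI[of _ "\<lambda>x. f' x * g x + g' x * f x"]) auto
  qed
qed (auto intro: continuous_on_mult)

lemma continuous_on_Union_rel:
  fixes f :: "(nat \<Rightarrow> real) \<Rightarrow> real"
  assumes "\<And>S. S \<in> \<S> \<Longrightarrow> openin (Euclidean_space n) S"
    and "\<And>S. S \<in> \<S> \<Longrightarrow> continuous_on S f"
  shows "continuous_on (\<Union>\<S>) f"
  unfolding continuous_on_def
proof
  fix x assume "x \<in> \<Union>\<S>"
  then obtain S where S: "S \<in> \<S>" "x \<in> S" by blast
  obtain W where W: "openin (powertop_real UNIV) W" "S = W \<inter> {x. \<forall>j\<ge>n. x j = 0}"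
    using assms(1)[OF S(1)] unfolding Euclidean_space_def openin_subtopology by auto
  have "\<Union>\<S> \<subseteq> {x. \<forall>j\<ge>n. x j = 0}"
    using assms(1) openin_subset by (fastforce simp: topspace_Euclidean_space)
  then have "\<Union>\<S> \<inter> W - {x} = S \<inter> W - {x}" using W(2) S by blast
  moreover have "open W" using W(1) by (simp add: open_fun_def)
  ultimately have "at x within \<Union>\<S> = at x within S"
    using W(2) S by (intro at_within_nhd[of x W]) auto
  then show "(f \<longlongrightarrow> f x) (at x within \<Union>\<S>)"
    using assms(2)[OF S(1)] S(2) by (simp add: continuous_on_def)
qed

lemma Ck_Union:
  assumes "\<And>S. S \<in> \<S> \<Longrightarrow> openin (Euclidean_space n) S"
    and "\<And>S. S \<in> \<S> \<Longrightarrow> Ck k n S f"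
  shows "Ck k n (\<Union>\<S>) f"
  using assms(2)
proof (induction k arbitrary: f)
  case 0
  then show ?case using continuous_on_Union_rel[OF assms(1)] by simp
next
  case (Suc k)
  show ?case unfolding Ck.simps
  proof (intro conjI allI impI)
    show "continuous_on (\<Union>\<S>) f"
      using Suc.prems by (intro continuous_on_Union_rel[OF assms(1)]) auto
    fix i assume i: "i < n"
    define h where "h = (\<lambda>y. deriv (\<lambda>t. f (y(i := t))) (y i))"
    have h: "(\<forall>y\<in>S. ((\<lambda>t. f (y(i := t))) has_real_derivative h y) (at (y i))) \<and> Ck k n S h"
      if S: "S \<in> \<S>" for S
    proof -
      obtain g where g: "\<forall>y\<in>S. ((\<lambda>t. f (y(i := t))) has_real_derivative g y) (at (y i))" "Ck k n S g"
        using Suc.prems[OF S] i by auto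
      have "g y = h y" if "y \<in> S" for y
        using g(1) that unfolding h_def by (metis DERIV_imp_deriv)
      then show ?thesis using g Ck_cong[OF assms(1)[OF S], of g h] by metis
    qed
    have "Ck k n (\<Union>\<S>) h" using h by (intro Suc.IH) auto
    then show "\<exists>g. (\<forall>y\<in>\<Union>\<S>. ((\<lambda>t. f (y(i := t))) has_real_derivative g y) (at (y i))) \<and> Ck k n (\<Union>\<S>) g"
      using h by (intro exI[of _ h]) auto
  qed
qed

lemma smooth_fun_on_const: "smooth_fun_on E W (\<lambda>_. c)"
  by (auto simp: smooth_fun_on_def Csmooth_def o_def Ck_const)

lemma smooth_fun_on_add:
  "smooth_fun_on E W f \<Longrightarrow> smooth_fun_on E W g \<Longrightarrow> smooth_fun_on E W (\<lambda>x. f x + g x)"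
  by (fastforce simp: smooth_fun_on_def Csmooth_def o_def intro: Ck_add)

lemma smooth_fun_on_mult:
  "smooth_fun_on E W f \<Longrightarrow> smooth_fun_on E W g \<Longrightarrow> smooth_fun_on E W (\<lambda>x. f x * g x)"
  by (fastforce simp: smooth_fun_on_def Csmooth_def o_def intro: Ck_mult)

lemma smooth_fun_on_minus: "smooth_fun_on E W f \<Longrightarrow> smooth_fun_on E W (\<lambda>x. - f x)"
  using smooth_fun_on_mult[OF smooth_fun_on_const[of E W "-1"], of f] by simp

lemma smooth_fun_on_diff:
  "smooth_fun_on E W f \<Longrightarrow> smooth_fun_on E W g \<Longrightarrow> smooth_fun_on E W (\<lambda>x. f x - g x)"
  using smooth_fun_on_add[of E W f "\<lambda>x. - g x"] smooth_fun_on_minus[of E W g] by simp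

lemma smooth_fun_on_sum:
  "(\<And>a. a \<in> I \<Longrightarrow> smooth_fun_on E W (f a)) \<Longrightarrow> smooth_fun_on E W (\<lambda>x. \<Sum>a\<in>I. f a x)"
  by (induction I rule: infinite_finite_induct)
     (auto intro: smooth_fun_on_add smooth_fun_on_const)

lemma chart_image_open:
  assumes "smooth_manifold E" "(U, \<phi>) \<in> atlas E" "open W"
  shows "openin (Euclidean_space (dim_base E)) (\<phi> ` (U \<inter> W))"
proof -
  have o: "openin (Euclidean_space (dim_base E)) (\<phi> ` U)"
    and h: "homeomorphism U (\<phi> ` U) \<phi> (inv_into U \<phi>)"
    using assms(1,2) unfolding smooth_manifold_def by blast+
  have "openin (top_of_set (\<phi> ` U)) (\<phi> ` (U \<inter> W))"
    using homeomorphism_imp_open_map[OF h] assms(3) by (simp add: openin_open_Int)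
  moreover have "top_of_set (\<phi> ` U) = subtopology (Euclidean_space (dim_base E)) (\<phi> ` U)"
    using openin_subset[OF o]
    by (simp add: Euclidean_space_def subtopology_subtopology euclidean_product_topology Int_absorb1)
  ultimately show ?thesis using o by (metis openin_trans_full)
qed

lemma smooth_fun_on_cong:
  assumes "smooth_manifold E" "open W" "\<And>x. x \<in> W \<Longrightarrow> f x = g x" "smooth_fun_on E W f"
  shows "smooth_fun_on E W g"
  unfolding smooth_fun_on_def Csmooth_def
proof (intro ballI, clarify)
  fix U \<phi> k assume U: "(U, \<phi>) \<in> atlas E"
  have inj: "inj_on \<phi> U"
    using assms(1) U unfolding smooth_manifold_def homeomorphism_def
    by (auto 0 3 intro: inj_on_inverseI)
  show "Ck k (dim_base E) (\<phi> ` (U \<inter> W)) (g \<circ> inv_into U \<phi>)"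
  proof (rule Ck_cong[OF chart_image_open[OF assms(1) U assms(2)]])
    show "Ck k (dim_base E) (\<phi> ` (U \<inter> W)) (f \<circ> inv_into U \<phi>)"
      using assms(4) U unfolding smooth_fun_on_def Csmooth_def by blast
  qed (use assms(3) inj in \<open>auto\<close>)
qed

lemma smooth_fun_local:
  assumes "smooth_manifold E" "\<And>W. W \<in> \<W> \<Longrightarrow> open W" "\<And>W. W \<in> \<W> \<Longrightarrow> smooth_fun_on E W f" "\<Union>\<W> = UNIV"
  shows "smooth_fun E f"
  unfolding smooth_fun_on_def Csmooth_def
proof (intro ballI, clarify)
  fix U \<phi> k assume U: "(U, \<phi>) \<in> atlas E"
  have "Ck k (dim_base E) (\<Union>((\<lambda>W. \<phi> ` (U \<inter> W)) ` \<W>)) (f \<circ> inv_into U \<phi>)"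
  proof (rule Ck_Union)
    fix S assume "S \<in> (\<lambda>W. \<phi> ` (U \<inter> W)) ` \<W>"
    then obtain W where W: "W \<in> \<W>" "S = \<phi> ` (U \<inter> W)" by (rule imageE)
    show "openin (Euclidean_space (dim_base E)) S"
      using chart_image_open[OF assms(1) U assms(2)[OF W(1)]] W(2) by simp
    show "Ck k (dim_base E) S (f \<circ> inv_into U \<phi>)"
      using bspec[OF assms(3)[OF W(1), unfolded smooth_fun_on_def Csmooth_def] U] W(2) by simp
  qed
  moreover have "\<Union>((\<lambda>W. \<phi> ` (U \<inter> W)) ` \<W>) = \<phi> ` (U \<inter> UNIV)"
    using assms(4) by blast
  ultimately show "Ck k (dim_base E) (\<phi> ` (U \<inter> UNIV)) (f \<circ> inv_into U \<phi>)" by simp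
qed

subsection \<open>Linear algebra of a vector bundle\<close>

locale vbundle =
  fixes E :: "('m :: {t2_space, second_countable_topology}, 'v :: real_vector, 'z) algebroid_scheme"
  assumes vb: "vector_bundle E"
begin

lemma manifold: "smooth_manifold E"
  using vb by (simp add: vector_bundle_def)

lemma fibre_subspace: "subspace (fibre E x)"
  using vb by (simp add: vector_bundle_def)

lemmas fibre_closed [simp] =
  subspace_0[OF fibre_subspace] subspace_add[OF fibre_subspace]
  subspace_diff[OF fibre_subspace] subspace_scale[OF fibre_subspace] subspace_neg[OF fibre_subspace]

lemma obtain_frame:
  obtains U e where "(U, e) \<in> frames E" "x \<in> U"
proof -
  have "x \<in> (\<Union>(U, e)\<in>frames E. U)" using vb by (simp only: vector_bundle_def UNIV_I)
  then show ?thesis using that by auto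
qed

lemma frame:
  assumes "(U, e) \<in> frames E"
  shows "open U"
    and "x \<in> U \<Longrightarrow> inj_on (\<lambda>a. e a x) {..<rank_bundle E}"
    and "x \<in> U \<Longrightarrow> independent ((\<lambda>a. e a x) ` {..<rank_bundle E})"
    and "x \<in> U \<Longrightarrow> span ((\<lambda>a. e a x) ` {..<rank_bundle E}) = fibre E x"
proof -
  have "\<forall>(U, e)\<in>frames E. open U \<and>
       (\<forall>x\<in>U. inj_on (\<lambda>a. e a x) {..<rank_bundle E} \<and>
              independent ((\<lambda>a. e a x) ` {..<rank_bundle E}) \<and>
              span ((\<lambda>a. e a x) ` {..<rank_bundle E}) = fibre E x)"
    using vb unfolding vector_bundle_def by (elim conjE)
  from bspec[OF this assms]
  show "open U"
    and "x \<in> U \<Longrightarrow> inj_on (\<lambda>a. e a x) {..<rank_bundle E}"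
    and "x \<in> U \<Longrightarrow> independent ((\<lambda>a. e a x) ` {..<rank_bundle E})"
    and "x \<in> U \<Longrightarrow> span ((\<lambda>a. e a x) ` {..<rank_bundle E}) = fibre E x"
    by simp_all
qed

lemma frame_in_fibre: "(U, e) \<in> frames E \<Longrightarrow> x \<in> U \<Longrightarrow> a < rank_bundle E \<Longrightarrow> e a x \<in> fibre E x"
  using frame(4)[of U e x] span_base[of "e a x" "(\<lambda>a. e a x) ` {..<rank_bundle E}"] by simp

lemma coframe_dual:
  assumes "(U, e) \<in> frames E" "x \<in> U"
  shows "coframe E e x a \<in> dual_fibre E x"
proof -
  note f = frame(3)[OF assms] frame(4)[OF assms]
  show ?thesis
    unfolding dual_fibre_def coframe_def mem_Collect_eq
  proof (intro conjI ballI allI impI)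
    fix u v assume "u \<in> fibre E x" "v \<in> fibre E x"
    then show "representation ((\<lambda>b. e b x) ` {..<rank_bundle E}) (u + v) (e a x) =
      representation ((\<lambda>b. e b x) ` {..<rank_bundle E}) u (e a x) +
      representation ((\<lambda>b. e b x) ` {..<rank_bundle E}) v (e a x)"
      using f by (simp add: representation_add)
  next
    fix u c assume "u \<in> fibre E x"
    then show "representation ((\<lambda>b. e b x) ` {..<rank_bundle E}) (c *\<^sub>R u) (e a x) =
      c * representation ((\<lambda>b. e b x) ` {..<rank_bundle E}) u (e a x)"
      using f by (simp add: representation_scale)
  next
    fix u assume "u \<notin> fibre E x"
    then show "representation ((\<lambda>b. e b x) ` {..<rank_bundle E}) u (e a x) = 0"
      using f by (simp add: representation_def)
  qed
qed

lemma coframe_expand: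
  assumes "(U, e) \<in> frames E" "x \<in> U" "v \<in> fibre E x"
  shows "(\<Sum>a<rank_bundle E. coframe E e x a v *\<^sub>R e a x) = v"
proof -
  let ?B = "(\<lambda>a. e a x) ` {..<rank_bundle E}"
  have "(\<Sum>b\<in>?B. representation ?B v b *\<^sub>R b) = v"
    using frame(4)[OF assms(1,2)] assms(3)
    by (intro real_vector.sum_representation_eq frame(3)[OF assms(1,2)]) simp_all
  then show ?thesis
    unfolding coframe_def by (subst (asm) sum.reindex[OF frame(2)[OF assms(1,2)]]) simp
qed

lemma dual_simps:
  assumes "\<alpha> \<in> dual_fibre E x"
  shows "u \<in> fibre E x \<Longrightarrow> v \<in> fibre E x \<Longrightarrow> \<alpha> (u + v) = \<alpha> u + \<alpha> v"
    and "u \<in> fibre E x \<Longrightarrow> \<alpha> (c *\<^sub>R u) = c * \<alpha> u"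
    and "u \<notin> fibre E x \<Longrightarrow> \<alpha> u = 0"
  using assms by (auto simp: dual_fibre_def)

lemma dual_minus:
  assumes "\<alpha> \<in> dual_fibre E x" "u \<in> fibre E x"
  shows "\<alpha> (- u) = - \<alpha> u"
  using dual_simps(2)[OF assms, of "-1"] by simp

lemma dual_diff:
  assumes "\<alpha> \<in> dual_fibre E x" "u \<in> fibre E x" "v \<in> fibre E x"
  shows "\<alpha> (u - v) = \<alpha> u - \<alpha> v"
  using dual_simps(1)[OF assms(1,2), of "- v"] assms by (simp add: dual_minus)

lemma dual_sum:
  assumes "\<alpha> \<in> dual_fibre E x" "\<And>a. a \<in> I \<Longrightarrow> u a \<in> fibre E x"
  shows "\<alpha> (\<Sum>a\<in>I. c a *\<^sub>R u a) = (\<Sum>a\<in>I. c a * \<alpha> (u a))"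
  using assms(2)
proof (induction I rule: infinite_finite_induct)
  case (insert a I)
  have "(\<Sum>a\<in>I. c a *\<^sub>R u a) \<in> fibre E x"
    using insert by (intro subspace_sum fibre_subspace) auto
  then show ?case using insert assms(1) by (simp add: dual_simps)
qed (use dual_simps(2)[OF assms(1), of 0 0] in auto)

lemma dual_expand:
  assumes "(U, e) \<in> frames E" "x \<in> U" "\<alpha> \<in> dual_fibre E x"
  shows "\<alpha> = (\<lambda>v. \<Sum>a<rank_bundle E. \<alpha> (e a x) * coframe E e x a v)"
proof
  fix v
  show "\<alpha> v = (\<Sum>a<rank_bundle E. \<alpha> (e a x) * coframe E e x a v)"
  proof (cases "v \<in> fibre E x")
    case True
    have "\<alpha> v = \<alpha> (\<Sum>a<rank_bundle E. coframe E e x a v *\<^sub>R e a x)"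
      using coframe_expand[OF assms(1,2) True] by simp
    also have "\<dots> = (\<Sum>a<rank_bundle E. coframe E e x a v * \<alpha> (e a x))"
      using assms frame_in_fibre by (intro dual_sum) auto
    finally show ?thesis by (simp add: mult.commute)
  next
    case False
    then show ?thesis
      by (simp add: dual_simps(3)[OF assms(3)] dual_simps(3)[OF coframe_dual[OF assms(1,2)]])
  qed
qed

lemma dual_zero: "(\<lambda>v. 0) \<in> dual_fibre E x"
  by (simp add: dual_fibre_def)

lemma dual_add: "\<alpha> \<in> dual_fibre E x \<Longrightarrow> \<beta> \<in> dual_fibre E x \<Longrightarrow> (\<lambda>v. \<alpha> v + \<beta> v) \<in> dual_fibre E x"
  by (simp add: dual_fibre_def algebra_simps)

lemma dual_scale: "\<alpha> \<in> dual_fibre E x \<Longrightarrow> (\<lambda>v. c * \<alpha> v) \<in> dual_fibre E x"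
  by (simp add: dual_fibre_def algebra_simps)

lemma dual_lincomb:
  "(\<And>a. a \<in> I \<Longrightarrow> \<alpha> a \<in> dual_fibre E x) \<Longrightarrow> (\<lambda>v. \<Sum>a\<in>I. c a * \<alpha> a v) \<in> dual_fibre E x"
  by (induction I rule: infinite_finite_induct) (auto simp: dual_zero intro!: dual_add dual_scale)

lemma fibre_eqI:
  assumes "u \<in> fibre E x" "v \<in> fibre E x" "\<And>\<beta>. \<beta> \<in> dual_fibre E x \<Longrightarrow> \<beta> u = \<beta> v"
  shows "u = v"
proof -
  obtain U e where U: "(U, e) \<in> frames E" "x \<in> U" by (rule obtain_frame)
  have "u = (\<Sum>a<rank_bundle E. coframe E e x a u *\<^sub>R e a x)"
    using coframe_expand[OF U assms(1)] by simp
  also have "\<dots> = (\<Sum>a<rank_bundle E. coframe E e x a v *\<^sub>R e a x)"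
    by (simp only: assms(3)[OF coframe_dual[OF U]])
  also have "\<dots> = v" using coframe_expand[OF U assms(2)] by simp
  finally show ?thesis .
qed

lemma bivector_simps:
  assumes "bivector E P" "\<alpha> \<in> dual_fibre E x" "\<beta> \<in> dual_fibre E x"
  shows "\<gamma> \<in> dual_fibre E x \<Longrightarrow> P x (\<lambda>v. \<alpha> v + \<beta> v) \<gamma> = P x \<alpha> \<gamma> + P x \<beta> \<gamma>"
    and "P x (\<lambda>v. c * \<alpha> v) \<beta> = c * P x \<alpha> \<beta>"
    and "P x \<alpha> \<beta> = - P x \<beta> \<alpha>"
  using assms unfolding bivector_def by blast+

lemma bivector_simps_right:
  assumes "bivector E P" "\<alpha> \<in> dual_fibre E x" "\<beta> \<in> dual_fibre E x"
  shows "\<gamma> \<in> dual_fibre E x \<Longrightarrow> P x \<gamma> (\<lambda>v. \<alpha> v + \<beta> v) = P x \<gamma> \<alpha> + P x \<gamma> \<beta>"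
    and "P x \<beta> (\<lambda>v. c * \<alpha> v) = c * P x \<beta> \<alpha>"
proof -
  show "P x \<gamma> (\<lambda>v. \<alpha> v + \<beta> v) = P x \<gamma> \<alpha> + P x \<gamma> \<beta>" if \<gamma>: "\<gamma> \<in> dual_fibre E x"
    using bivector_simps(1)[OF assms \<gamma>] bivector_simps(3)[OF assms(1) \<gamma> dual_add[OF assms(2,3)]]
      bivector_simps(3)[OF assms(1) \<gamma> assms(2)] bivector_simps(3)[OF assms(1) \<gamma> assms(3)] by simp
  show "P x \<beta> (\<lambda>v. c * \<alpha> v) = c * P x \<beta> \<alpha>"
    using bivector_simps(2)[OF assms, of c] bivector_simps(3)[OF assms(1,3) dual_scale[OF assms(2), of c]]
      bivector_simps(3)[OF assms(1,3,2)] by simp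
qed

lemma bivector_lincomb_right:
  assumes "bivector E P" "\<alpha> \<in> dual_fibre E x" "\<And>a. a \<in> I \<Longrightarrow> \<beta> a \<in> dual_fibre E x"
  shows "P x \<alpha> (\<lambda>v. \<Sum>a\<in>I. c a * \<beta> a v) = (\<Sum>a\<in>I. c a * P x \<alpha> (\<beta> a))"
  using assms(3)
proof (induction I rule: infinite_finite_induct)
  case (insert a I)
  then show ?case
    using bivector_simps_right(1)[OF assms(1) dual_scale[of "\<beta> a" x "c a"] dual_lincomb[of I \<beta> x c] assms(2)]
      bivector_simps_right(2)[OF assms(1) _ assms(2), of "\<beta> a" "c a"] by simp
qed (use bivector_simps_right(2)[OF assms(1) dual_zero assms(2), of 0] in auto)

lemma bivector_lincomb_left:
  assumes "bivector E P" "\<alpha> \<in> dual_fibre E x" "\<And>a. a \<in> I \<Longrightarrow> \<beta> a \<in> dual_fibre E x"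
  shows "P x (\<lambda>v. \<Sum>a\<in>I. c a * \<beta> a v) \<alpha> = (\<Sum>a\<in>I. c a * P x (\<beta> a) \<alpha>)"
proof -
  have "P x (\<lambda>v. \<Sum>a\<in>I. c a * \<beta> a v) \<alpha> = - (\<Sum>a\<in>I. c a * P x \<alpha> (\<beta> a))"
    using bivector_simps(3)[OF assms(1) dual_lincomb[of I \<beta> x c] assms(2)] assms(3)
      bivector_lincomb_right[OF assms] by simp
  also have "\<dots> = (\<Sum>a\<in>I. c a * P x (\<beta> a) \<alpha>)"
    using bivector_simps(3)[OF assms(1) assms(2) assms(3)] by (simp add: sum_negf[symmetric])
  finally show ?thesis .
qed

lemma sharp_unique:
  assumes "u \<in> fibre E x" "\<And>\<beta>. \<beta> \<in> dual_fibre E x \<Longrightarrow> \<beta> u = P x \<alpha> \<beta>"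
  shows "sharp E P x \<alpha> = u"
  unfolding sharp_def
  by (rule the_equality) (use assms in \<open>auto intro: fibre_eqI\<close>)

lemma sharp:
  assumes P: "bivector E P" and \<alpha>: "\<alpha> \<in> dual_fibre E x"
  shows "sharp E P x \<alpha> \<in> fibre E x"
    and "\<beta> \<in> dual_fibre E x \<Longrightarrow> \<beta> (sharp E P x \<alpha>) = P x \<alpha> \<beta>"
proof -
  obtain U e where U: "(U, e) \<in> frames E" "x \<in> U" by (rule obtain_frame)
  define u where "u = (\<Sum>a<rank_bundle E. P x \<alpha> (coframe E e x a) *\<^sub>R e a x)"
  have u: "u \<in> fibre E x"
    unfolding u_def using frame_in_fibre[OF U] by (intro subspace_sum fibre_subspace) auto
  have b: "\<beta> u = P x \<alpha> \<beta>" if \<beta>: "\<beta> \<in> dual_fibre E x" for \<beta>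
  proof -
    have "\<beta> u = (\<Sum>a<rank_bundle E. \<beta> (e a x) * P x \<alpha> (coframe E e x a))"
      unfolding u_def by (subst dual_sum[OF \<beta>]) (use frame_in_fibre[OF U] in \<open>auto simp: mult.commute\<close>)
    also have "\<dots> = P x \<alpha> \<beta>"
      by (subst (2) dual_expand[OF U \<beta>], subst bivector_lincomb_right[OF P \<alpha> coframe_dual[OF U]]) simp
    finally show ?thesis .
  qed
  have "sharp E P x \<alpha> = u" using u b by (rule sharp_unique)
  then show "sharp E P x \<alpha> \<in> fibre E x" "\<beta> \<in> dual_fibre E x \<Longrightarrow> \<beta> (sharp E P x \<alpha>) = P x \<alpha> \<beta>"
    using u b by auto
qed



subsection \<open>Smoothness\<close>

lemma smooth_fun_frames:
  assumes "\<And>U e. (U, e) \<in> frames E \<Longrightarrow> smooth_fun_on E U f"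
  shows "smooth_fun E f"
proof (rule smooth_fun_local[OF manifold, of "fst ` frames E"])
  show "\<Union>(fst ` frames E) = UNIV"
    using vb unfolding vector_bundle_def by (auto simp: case_prod_beta)
qed (use assms frame(1) in auto)

lemma smooth_fun_on_open:
  assumes "smooth_fun E f" "open W"
  shows "smooth_fun_on E W f"
  unfolding smooth_fun_on_def Csmooth_def
proof (intro ballI, clarify)
  fix U \<phi> k assume U: "(U, \<phi>) \<in> atlas E"
  have *: "Ck k n T h" if "Ck k n S h" "T \<subseteq> S" for k n S T and h :: "(nat \<Rightarrow> real) \<Rightarrow> real"
    using that
  proof (induction k arbitrary: h)
    case 0
    then show ?case by (auto intro: continuous_on_subset)
  next
    case (Suc k)
    then show ?case by simp (meson continuous_on_subset subsetD)
  qed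
  have "Ck k (dim_base E) (\<phi> ` (U \<inter> UNIV)) (f \<circ> inv_into U \<phi>)"
    using assms(1) U unfolding smooth_fun_on_def Csmooth_def by blast
  then show "Ck k (dim_base E) (\<phi> ` (U \<inter> W)) (f \<circ> inv_into U \<phi>)"
    by (rule *) auto
qed

lemma section_fibre: "is_section E X \<Longrightarrow> X x \<in> fibre E x"
  by (simp add: is_section_def)

lemma one_form_dual: "one_form E \<alpha> \<Longrightarrow> \<alpha> x \<in> dual_fibre E x"
  by (simp add: one_form_def)

lemma one_form_smooth:
  assumes "one_form E \<alpha>" "(U, e) \<in> frames E" "a < rank_bundle E"
  shows "smooth_fun_on E U (\<lambda>x. \<alpha> x (e a x))"
  using bspec[OF conjunct2[OF assms(1)[unfolded one_form_def]] assms(2)] assms(3) by simp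

lemma bivector_smooth:
  assumes "bivector E P" "(U, e) \<in> frames E" "a < rank_bundle E" "b < rank_bundle E"
  shows "smooth_fun_on E U (\<lambda>x. P x (coframe E e x a) (coframe E e x b))"
  using bspec[OF conjunct2[OF assms(1)[unfolded bivector_def]] assms(2)] assms(3,4) by simp

lemma section_smooth:
  assumes "is_section E X" "(U, e) \<in> frames E" "a < rank_bundle E"
  shows "smooth_fun_on E U (\<lambda>x. coframe E e x a (X x))"
  using bspec[OF conjunct2[OF assms(1)[unfolded is_section_def]] assms(2)] assms(3) by simp

lemma sectionI:
  assumes "\<And>x. X x \<in> fibre E x"
    and "\<And>U e a. (U, e) \<in> frames E \<Longrightarrow> a < rank_bundle E \<Longrightarrow> smooth_fun_on E U (\<lambda>x. coframe E e x a (X x))"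
  shows "is_section E X"
  using assms by (auto simp: is_section_def)

lemma smooth_pairing:
  assumes "one_form E \<alpha>" "is_section E X"
  shows "smooth_fun E (\<lambda>x. \<alpha> x (X x))"
proof (rule smooth_fun_frames)
  fix U e assume U: "(U, e) \<in> frames E"
  show "smooth_fun_on E U (\<lambda>x. \<alpha> x (X x))"
  proof (rule smooth_fun_on_cong[OF manifold frame(1)[OF U]])
    show "(\<Sum>a<rank_bundle E. \<alpha> x (e a x) * coframe E e x a (X x)) = \<alpha> x (X x)" if "x \<in> U" for x
      using dual_expand[OF U that one_form_dual[OF assms(1)]] by metis
    show "smooth_fun_on E U (\<lambda>x. \<Sum>a<rank_bundle E. \<alpha> x (e a x) * coframe E e x a (X x))"
      by (intro smooth_fun_on_sum smooth_fun_on_mult one_form_smooth[OF assms(1) U]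
          section_smooth[OF assms(2) U]) simp_all
  qed
qed

lemma smooth_bivector_coframe:
  assumes P: "bivector E P" and \<alpha>: "one_form E \<alpha>" and U: "(U, e) \<in> frames E" and b: "b < rank_bundle E"
  shows "smooth_fun_on E U (\<lambda>x. P x (\<alpha> x) (coframe E e x b))"
proof (rule smooth_fun_on_cong[OF manifold frame(1)[OF U]])
  show "(\<Sum>a<rank_bundle E. \<alpha> x (e a x) * P x (coframe E e x a) (coframe E e x b)) =
      P x (\<alpha> x) (coframe E e x b)" if x: "x \<in> U" for x
    by (subst (2) dual_expand[OF U x one_form_dual[OF \<alpha>]],
        subst bivector_lincomb_left[OF P coframe_dual[OF U x] coframe_dual[OF U x]]) simp
  show "smooth_fun_on E U (\<lambda>x. \<Sum>a<rank_bundle E. \<alpha> x (e a x) * P x (coframe E e x a) (coframe E e x b))"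
    by (intro smooth_fun_on_sum smooth_fun_on_mult one_form_smooth[OF \<alpha> U] bivector_smooth[OF P U] b)
       simp_all
qed

lemma sharp_section:
  assumes P: "bivector E P" and \<alpha>: "one_form E \<alpha>"
  shows "is_section E (\<lambda>x. sharp E P x (\<alpha> x))"
proof (rule sectionI)
  show "sharp E P x (\<alpha> x) \<in> fibre E x" for x
    by (rule sharp(1)[OF P one_form_dual[OF \<alpha>]])
  fix U e a assume U: "(U, e) \<in> frames E" and a: "a < rank_bundle E"
  show "smooth_fun_on E U (\<lambda>x. coframe E e x a (sharp E P x (\<alpha> x)))"
    by (rule smooth_fun_on_cong[OF manifold frame(1)[OF U] _ smooth_bivector_coframe[OF P \<alpha> U a]])
       (simp add: sharp(2)[OF P one_form_dual[OF \<alpha>] coframe_dual[OF U]])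
qed

lemma smooth_bivector:
  assumes P: "bivector E P" and \<alpha>: "one_form E \<alpha>" and \<beta>: "one_form E \<beta>"
  shows "smooth_fun E (\<lambda>x. P x (\<alpha> x) (\<beta> x))"
  using smooth_pairing[OF \<beta> sharp_section[OF P \<alpha>]]
  by (simp add: sharp(2)[OF P one_form_dual[OF \<alpha>] one_form_dual[OF \<beta>]])

lemma section_add:
  assumes "is_section E X" "is_section E Y"
  shows "is_section E (\<lambda>x. X x + Y x)"
proof (rule sectionI)
  show "X x + Y x \<in> fibre E x" for x using assms section_fibre by simp
  fix U e a assume U: "(U, e) \<in> frames E" and a: "a < rank_bundle E"
  show "smooth_fun_on E U (\<lambda>x. coframe E e x a (X x + Y x))"
    by (rule smooth_fun_on_cong[OF manifold frame(1)[OF U] _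
          smooth_fun_on_add[OF section_smooth[OF assms(1) U a] section_smooth[OF assms(2) U a]]])
       (simp add: dual_simps(1)[OF coframe_dual[OF U]] section_fibre assms)
qed

lemma section_scale:
  assumes "smooth_fun E f" "is_section E X"
  shows "is_section E (\<lambda>x. f x *\<^sub>R X x)"
proof (rule sectionI)
  show "f x *\<^sub>R X x \<in> fibre E x" for x using assms section_fibre by simp
  fix U e a assume U: "(U, e) \<in> frames E" and a: "a < rank_bundle E"
  show "smooth_fun_on E U (\<lambda>x. coframe E e x a (f x *\<^sub>R X x))"
    by (rule smooth_fun_on_cong[OF manifold frame(1)[OF U] _
          smooth_fun_on_mult[OF smooth_fun_on_open[OF assms(1) frame(1)[OF U]] section_smooth[OF assms(2) U a]]])
       (simp add: dual_simps(2)[OF coframe_dual[OF U]] section_fibre assms)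
qed

lemma section_uminus: "is_section E X \<Longrightarrow> is_section E (\<lambda>x. - X x)"
  using section_scale[OF smooth_fun_on_const[of E UNIV "-1"], of X] by simp

lemma section_diff: "is_section E X \<Longrightarrow> is_section E Y \<Longrightarrow> is_section E (\<lambda>x. X x - Y x)"
  using section_add[OF _ section_uminus, of X Y] by simp

end

subsection \<open>Computation of the bracket\<close>

locale lalgebroid =
  fixes E :: "('m :: {t2_space, second_countable_topology}, 'v :: real_vector, 'z) algebroid_scheme"
  assumes la: "lie_algebroid E"

sublocale lalgebroid \<subseteq> vbundle
  by unfold_locales (use la in \<open>simp add: lie_algebroid_def\<close>)

context lalgebroid
begin

lemma anchor_fun:
  assumes "v \<in> fibre E x" "smooth_fun E f" "smooth_fun E g"
  shows anchor_fun_add: "anchor E x v (\<lambda>y. f y + g y) = anchor E x v f + anchor E x v g"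
    and anchor_fun_scale: "anchor E x v (\<lambda>y. c * f y) = c * anchor E x v f"
    and anchor_fun_mult: "anchor E x v (\<lambda>y. f y * g y) = anchor E x v f * g x + f x * anchor E x v g"
proof -
  have "\<forall>x. \<forall>v\<in>fibre E x. \<forall>f g. smooth_fun E f \<longrightarrow> smooth_fun E g \<longrightarrow>
       anchor E x v (\<lambda>y. f y + g y) = anchor E x v f + anchor E x v g \<and>
       (\<forall>c. anchor E x v (\<lambda>y. c * f y) = c * anchor E x v f) \<and>
       anchor E x v (\<lambda>y. f y * g y) = anchor E x v f * g x + f x * anchor E x v g"
    using la unfolding lie_algebroid_def by (elim conjE)
  from this[rule_format, OF assms]
  show "anchor E x v (\<lambda>y. f y + g y) = anchor E x v f + anchor E x v g"
    "anchor E x v (\<lambda>y. c * f y) = c * anchor E x v f"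
    "anchor E x v (\<lambda>y. f y * g y) = anchor E x v f * g x + f x * anchor E x v g"
    by simp_all
qed

lemma anchor_fun_diff:
  assumes "v \<in> fibre E x" "smooth_fun E f" "smooth_fun E g"
  shows "anchor E x v (\<lambda>y. f y - g y) = anchor E x v f - anchor E x v g"
  using anchor_fun_add[OF assms(1,2) smooth_fun_on_minus[OF assms(3)]]
    anchor_fun_scale[OF assms(1,3,3), of "-1"] by simp

lemma anchor_vec:
  assumes "u \<in> fibre E x" "v \<in> fibre E x" "smooth_fun E f"
  shows anchor_vec_add: "anchor E x (u + v) f = anchor E x u f + anchor E x v f"
    and anchor_vec_scale: "anchor E x (c *\<^sub>R u) f = c * anchor E x u f"
proof -
  have "\<forall>x. \<forall>u\<in>fibre E x. \<forall>v\<in>fibre E x. \<forall>c f. smooth_fun E f \<longrightarrow>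
       anchor E x (u + v) f = anchor E x u f + anchor E x v f \<and>
       anchor E x (c *\<^sub>R u) f = c * anchor E x u f"
    using la unfolding lie_algebroid_def by (elim conjE)
  from this[rule_format, OF assms]
  show "anchor E x (u + v) f = anchor E x u f + anchor E x v f"
    "anchor E x (c *\<^sub>R u) f = c * anchor E x u f" by simp_all
qed

lemma anchor_vec_diff:
  assumes "u \<in> fibre E x" "v \<in> fibre E x" "smooth_fun E f"
  shows "anchor E x (u - v) f = anchor E x u f - anchor E x v f"
  using anchor_vec_add[of u x "- v" f] anchor_vec_scale[of v x v f "-1"] assms by simp

lemma bracket_section:
  assumes "is_section E X" "is_section E Y"
  shows "is_section E (bracket E X Y)"
proof -
  have "\<forall>X Y. is_section E X \<longrightarrow> is_section E Y \<longrightarrow> is_section E (bracket E X Y)"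
    using la unfolding lie_algebroid_def by (elim conjE)
  from this[rule_format, OF assms] show ?thesis .
qed

lemma bracket_add_left:
  assumes "is_section E X" "is_section E Y" "is_section E Z"
  shows "bracket E (\<lambda>y. X y + Y y) Z x = bracket E X Z x + bracket E Y Z x"
proof -
  have "\<forall>X Y Z. is_section E X \<longrightarrow> is_section E Y \<longrightarrow> is_section E Z \<longrightarrow>
       (\<forall>x. bracket E (\<lambda>y. X y + Y y) Z x = bracket E X Z x + bracket E Y Z x)"
    using la unfolding lie_algebroid_def by (elim conjE)
  from this[rule_format, OF assms] show ?thesis .
qed

lemma bracket_skew:
  assumes "is_section E X" "is_section E Y"
  shows "bracket E X Y x = - bracket E Y X x"
proof -
  have "\<forall>X Y. is_section E X \<longrightarrow> is_section E Y \<longrightarrow> (\<forall>x. bracket E X Y x = - bracket E Y X x)"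
    using la unfolding lie_algebroid_def by (elim conjE)
  from this[rule_format, OF assms] show ?thesis .
qed

lemma bracket_leibniz:
  assumes "is_section E X" "is_section E Y" "smooth_fun E f"
  shows "bracket E X (\<lambda>y. f y *\<^sub>R Y y) x = f x *\<^sub>R bracket E X Y x + anchor E x (X x) f *\<^sub>R Y x"
proof -
  have "\<forall>X Y f. is_section E X \<longrightarrow> is_section E Y \<longrightarrow> smooth_fun E f \<longrightarrow>
       (\<forall>x. bracket E X (\<lambda>y. f y *\<^sub>R Y y) x = f x *\<^sub>R bracket E X Y x + anchor E x (X x) f *\<^sub>R Y x)"
    using la unfolding lie_algebroid_def by (elim conjE)
  from this[rule_format, OF assms] show ?thesis .
qed

lemma d_one_skew:
  assumes "one_form E \<alpha>" "is_section E X" "is_section E Y"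
  shows "d_one E \<alpha> Y X x = - d_one E \<alpha> X Y x"
  unfolding d_one_def bracket_skew[OF assms(2,3), of x]
  by (simp add: dual_minus[OF one_form_dual[OF assms(1)] section_fibre[OF bracket_section[OF assms(3,2)]]])

lemma d_one_add_left:
  assumes "one_form E \<alpha>" "is_section E X" "is_section E Y" "is_section E Z"
  shows "d_one E \<alpha> (\<lambda>y. X y + Y y) Z x = d_one E \<alpha> X Z x + d_one E \<alpha> Y Z x"
proof -
  have *: "(\<lambda>y. \<alpha> y (X y + Y y)) = (\<lambda>y. \<alpha> y (X y) + \<alpha> y (Y y))"
    using dual_simps(1)[OF one_form_dual[OF assms(1)] section_fibre[OF assms(2)] section_fibre[OF assms(3)]]
    by blast
  show ?thesis
    unfolding d_one_def * bracket_add_left[OF assms(2,3,4)]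
    by (simp add: anchor_vec_add[OF section_fibre[OF assms(2)] section_fibre[OF assms(3)] smooth_pairing[OF assms(1,4)]]
        anchor_fun_add[OF section_fibre[OF assms(4)] smooth_pairing[OF assms(1,2)] smooth_pairing[OF assms(1,3)]]
        dual_simps(1)[OF one_form_dual[OF assms(1)] section_fibre[OF bracket_section[OF assms(2,4)]]
          section_fibre[OF bracket_section[OF assms(3,4)]]])
qed

lemma d_one_scale_right:
  assumes "one_form E \<alpha>" "is_section E X" "is_section E Y" "smooth_fun E f"
  shows "d_one E \<alpha> X (\<lambda>y. f y *\<^sub>R Y y) x = f x * d_one E \<alpha> X Y x"
proof -
  have *: "(\<lambda>y. \<alpha> y (f y *\<^sub>R Y y)) = (\<lambda>y. f y * \<alpha> y (Y y))"
    using dual_simps(2)[OF one_form_dual[OF assms(1)] section_fibre[OF assms(3)]] by blast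
  note f = section_fibre[OF bracket_section[OF assms(2,3)], of x] section_fibre[OF assms(3), of x]
  show ?thesis
    unfolding d_one_def * bracket_leibniz[OF assms(2,3,4)]
    by (simp add: anchor_vec_scale[OF f(2) f(2) smooth_pairing[OF assms(1,2)]]
        anchor_fun_mult[OF section_fibre[OF assms(2)] assms(4) smooth_pairing[OF assms(1,3)]]
        dual_simps(1)[OF one_form_dual[OF assms(1)] fibre_closed(4)[OF f(1)] fibre_closed(4)[OF f(2)]]
        dual_simps(2)[OF one_form_dual[OF assms(1)] f(1)] dual_simps(2)[OF one_form_dual[OF assms(1)] f(2)]
        algebra_simps)
qed

lemma d_one_scale_left:
  assumes "one_form E \<alpha>" "is_section E X" "is_section E Y" "smooth_fun E f"
  shows "d_one E \<alpha> (\<lambda>y. f y *\<^sub>R X y) Y x = f x * d_one E \<alpha> X Y x"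
  using d_one_scale_right[OF assms(1,3,2,4), of x]
    d_one_skew[OF assms(1,3) section_scale[OF assms(4,2)], of x] d_one_skew[OF assms(1,3,2), of x]
  by simp

lemma d_one_add_right:
  assumes "one_form E \<alpha>" "is_section E X" "is_section E Y" "is_section E Z"
  shows "d_one E \<alpha> Z (\<lambda>y. X y + Y y) x = d_one E \<alpha> Z X x + d_one E \<alpha> Z Y x"
  using d_one_add_left[OF assms, of x] d_one_skew[OF assms(1,4) section_add[OF assms(2,3)], of x]
    d_one_skew[OF assms(1,4,2), of x] d_one_skew[OF assms(1,4,3), of x]
  by simp

lemma d_one_diff_left:
  assumes "one_form E \<alpha>" "is_section E X" "is_section E Y" "is_section E Z"
  shows "d_one E \<alpha> (\<lambda>y. X y - Y y) Z x = d_one E \<alpha> X Z x - d_one E \<alpha> Y Z x"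
  using d_one_add_left[OF assms(1,2) section_uminus[OF assms(3)] assms(4), of x]
    d_one_scale_left[OF assms(1,3,4) smooth_fun_on_const[of E UNIV "-1"], of x]
  by simp

lemma d_one_diff_right:
  assumes "one_form E \<alpha>" "is_section E X" "is_section E Y" "is_section E Z"
  shows "d_one E \<alpha> Z (\<lambda>y. X y - Y y) x = d_one E \<alpha> Z X x - d_one E \<alpha> Z Y x"
  using d_one_add_right[OF assms(1,2) section_uminus[OF assms(3)] assms(4), of x]
    d_one_scale_right[OF assms(1,4,3) smooth_fun_on_const[of E UNIV "-1"], of x]
  by simp

lemma schouten_commute: "schouten E P Q \<alpha> \<beta> \<gamma> x = schouten E Q P \<alpha> \<beta> \<gamma> x"
  by (simp add: schouten_def)

lemma schouten_add_left:
  assumes P: "bivector E P" and P': "bivector E P'" and Q: "bivector E Q"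
    and \<alpha>: "one_form E \<alpha>" and \<beta>: "one_form E \<beta>" and \<gamma>: "one_form E \<gamma>"
  shows "schouten E (\<lambda>y \<xi> \<eta>. P y \<xi> \<eta> + P' y \<xi> \<eta>) Q \<alpha> \<beta> \<gamma> x =
    schouten E P Q \<alpha> \<beta> \<gamma> x + schouten E P' Q \<alpha> \<beta> \<gamma> x"
proof -
  have S: "sharp E (\<lambda>y \<xi> \<eta>. P y \<xi> \<eta> + P' y \<xi> \<eta>) y (\<xi> y) = sharp E P y (\<xi> y) + sharp E P' y (\<xi> y)"
    if "one_form E \<xi>" for \<xi> y
    using one_form_dual[OF that, of y]
    by (intro sharp_unique) (simp_all add: sharp(1)[OF P] sharp(1)[OF P'] dual_simps(1) sharp(2)[OF P] sharp(2)[OF P'])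
  have sec: "is_section E (\<lambda>y. sharp E R y (\<xi> y))" if "R \<in> {P, P', Q}" "one_form E \<xi>" for R \<xi>
    using that P P' Q sharp_section by blast
  have fib: "sharp E R y (\<xi> y) \<in> fibre E y" if "R \<in> {P, P', Q}" "one_form E \<xi>" for R \<xi> y
    using section_fibre[OF sec[OF that]] .
  have sm: "smooth_fun E (\<lambda>y. R y (\<xi> y) (\<eta> y))" if "R \<in> {P, P', Q}" "one_form E \<xi>" "one_form E \<eta>" for R \<xi> \<eta>
    using that P P' Q smooth_bivector by blast
  show ?thesis
    unfolding schouten_def Let_def
    by (simp add: S \<alpha> \<beta> \<gamma> sec fib sm anchor_vec_add anchor_fun_add d_one_add_left d_one_add_right)
qed

lemma schouten_scale_left:
  assumes P: "bivector E P" and Q: "bivector E Q"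
    and \<alpha>: "one_form E \<alpha>" and \<beta>: "one_form E \<beta>" and \<gamma>: "one_form E \<gamma>"
  shows "schouten E (\<lambda>y \<xi> \<eta>. c * P y \<xi> \<eta>) Q \<alpha> \<beta> \<gamma> x = c * schouten E P Q \<alpha> \<beta> \<gamma> x"
proof -
  have S: "sharp E (\<lambda>y \<xi> \<eta>. c * P y \<xi> \<eta>) y (\<xi> y) = c *\<^sub>R sharp E P y (\<xi> y)"
    if "one_form E \<xi>" for \<xi> y
    using one_form_dual[OF that, of y]
    by (intro sharp_unique) (simp_all add: sharp(1)[OF P] dual_simps(2) sharp(2)[OF P])
  have sec: "is_section E (\<lambda>y. sharp E R y (\<xi> y))" if "R \<in> {P, Q}" "one_form E \<xi>" for R \<xi>
    using that P Q sharp_section by blast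
  have fib: "sharp E R y (\<xi> y) \<in> fibre E y" if "R \<in> {P, Q}" "one_form E \<xi>" for R \<xi> y
    using section_fibre[OF sec[OF that]] .
  have sm: "smooth_fun E (\<lambda>y. R y (\<xi> y) (\<eta> y))" if "R \<in> {P, Q}" "one_form E \<xi>" "one_form E \<eta>" for R \<xi> \<eta>
    using that P Q smooth_bivector by blast
  have dl: "d_one E \<xi> (\<lambda>y. c *\<^sub>R X y) Y x = c * d_one E \<xi> X Y x"
    and dr: "d_one E \<xi> X (\<lambda>y. c *\<^sub>R Y y) x = c * d_one E \<xi> X Y x"
    if "one_form E \<xi>" "is_section E X" "is_section E Y" for \<xi> X Y
    using d_one_scale_left[OF that smooth_fun_on_const] d_one_scale_right[OF that smooth_fun_on_const] by auto
  have av: "anchor E x (c *\<^sub>R u) f = c * anchor E x u f" if "u \<in> fibre E x" "smooth_fun E f" for u f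
    using anchor_vec_scale[OF that(1) that] .
  have af: "anchor E x u (\<lambda>y. c * f y) = c * anchor E x u f" if "u \<in> fibre E x" "smooth_fun E f" for u f
    using anchor_fun_scale[OF that that(2)] .
  show ?thesis
    unfolding schouten_def Let_def
    by (simp add: S \<alpha> \<beta> \<gamma> sec fib sm av af dl dr algebra_simps)
qed

end

definition wedge_two ::
  "('m \<Rightarrow> 'v) \<Rightarrow> ('m \<Rightarrow> 'v) \<Rightarrow> 'm \<Rightarrow> ('v \<Rightarrow> real) \<Rightarrow> ('v \<Rightarrow> real) \<Rightarrow> real" where
  "wedge_two X Y x \<alpha> \<beta> = \<alpha> (X x) * \<beta> (Y x) - \<alpha> (Y x) * \<beta> (X x)"

definition wedge_three ::
  "('m \<Rightarrow> 'v) \<Rightarrow> ('m \<Rightarrow> 'v) \<Rightarrow> ('m \<Rightarrow> 'v) \<Rightarrow>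
   'm \<Rightarrow> ('v \<Rightarrow> real) \<Rightarrow> ('v \<Rightarrow> real) \<Rightarrow> ('v \<Rightarrow> real) \<Rightarrow> real" where
  "wedge_three X Y Z x \<alpha> \<beta> \<gamma> =
    \<alpha> (X x) * wedge_two Y Z x \<beta> \<gamma> + \<beta> (X x) * wedge_two Y Z x \<gamma> \<alpha> + \<gamma> (X x) * wedge_two Y Z x \<alpha> \<beta>"

context lalgebroid
begin

lemma sharp_wedge_two:
  assumes "is_section E X" "is_section E Y"
  shows "sharp E (wedge_two X Y) x \<alpha> = \<alpha> (X x) *\<^sub>R Y x - \<alpha> (Y x) *\<^sub>R X x"
  by (rule sharp_unique)
     (simp_all add: section_fibre[OF assms(1)] section_fibre[OF assms(2)] dual_diff dual_simps(2) wedge_two_def)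

lemma bivector_wedge_two:
  assumes "is_section E X" "is_section E Y"
  shows "bivector E (wedge_two X Y)"
  unfolding bivector_def wedge_two_def
  by (auto simp: algebra_simps intro!: smooth_fun_on_diff smooth_fun_on_mult section_smooth assms)

lemma schouten_decomposable:
  assumes X: "is_section E X" and Y: "is_section E Y" and Z: "is_section E Z" and W: "is_section E W"
    and \<alpha>: "one_form E \<alpha>" and \<beta>: "one_form E \<beta>" and \<gamma>: "one_form E \<gamma>"
  shows "schouten E (wedge_two X Y) (wedge_two Z W) \<alpha> \<beta> \<gamma> x =
    wedge_three (bracket E X Z) Y W x (\<alpha> x) (\<beta> x) (\<gamma> x) -
    wedge_three (bracket E X W) Y Z x (\<alpha> x) (\<beta> x) (\<gamma> x) -
    wedge_three (bracket E Y Z) X W x (\<alpha> x) (\<beta> x) (\<gamma> x) +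
    wedge_three (bracket E Y W) X Z x (\<alpha> x) (\<beta> x) (\<gamma> x)"
proof -
  note sec = X Y Z W
  have sm: "smooth_fun E (\<lambda>y. \<xi> y (V y))" if "one_form E \<xi>" "V \<in> {X, Y, Z, W}" for \<xi> V
    using that smooth_pairing sec by blast
  have A: "anchor E x (a *\<^sub>R U x - b *\<^sub>R V x) (\<lambda>y. wedge_two U' V' y (\<xi> y) (\<eta> y)) =
      a * (anchor E x (U x) (\<lambda>y. \<xi> y (U' y)) * \<eta> x (V' x) + \<xi> x (U' x) * anchor E x (U x) (\<lambda>y. \<eta> y (V' y)) -
           anchor E x (U x) (\<lambda>y. \<xi> y (V' y)) * \<eta> x (U' x) - \<xi> x (V' x) * anchor E x (U x) (\<lambda>y. \<eta> y (U' y))) -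
      b * (anchor E x (V x) (\<lambda>y. \<xi> y (U' y)) * \<eta> x (V' x) + \<xi> x (U' x) * anchor E x (V x) (\<lambda>y. \<eta> y (V' y)) -
           anchor E x (V x) (\<lambda>y. \<xi> y (V' y)) * \<eta> x (U' x) - \<xi> x (V' x) * anchor E x (V x) (\<lambda>y. \<eta> y (U' y)))"
    if "is_section E U" "is_section E V" "is_section E U'" "is_section E V'" "one_form E \<xi>" "one_form E \<eta>"
    for a b U V U' V' \<xi> \<eta>
  proof -
    note f = section_fibre[OF that(1), of x] section_fibre[OF that(2), of x]
    note s = smooth_pairing[OF that(5,3)] smooth_pairing[OF that(5,4)]
      smooth_pairing[OF that(6,3)] smooth_pairing[OF that(6,4)]
    note m = smooth_fun_on_mult[OF s(1) s(4)] smooth_fun_on_mult[OF s(2) s(3)]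
    show ?thesis
      unfolding wedge_two_def
      by (simp add: anchor_vec_diff[OF fibre_closed(4)[OF f(1)] fibre_closed(4)[OF f(2)] smooth_fun_on_diff[OF m]]
          anchor_vec_scale[OF f(1) f(1) smooth_fun_on_diff[OF m]] anchor_vec_scale[OF f(2) f(2) smooth_fun_on_diff[OF m]]
          anchor_fun_diff[OF f(1) m] anchor_fun_diff[OF f(2) m]
          anchor_fun_mult[OF f(1) s(1) s(4)] anchor_fun_mult[OF f(1) s(2) s(3)]
          anchor_fun_mult[OF f(2) s(1) s(4)] anchor_fun_mult[OF f(2) s(2) s(3)] diff_diff_eq[symmetric])
  qed
  have D: "d_one E \<xi> (\<lambda>y. a y *\<^sub>R U y - b y *\<^sub>R V y) (\<lambda>y. c y *\<^sub>R U' y - d y *\<^sub>R V' y) x =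
      a x * c x * d_one E \<xi> U U' x - a x * d x * d_one E \<xi> U V' x -
      b x * c x * d_one E \<xi> V U' x + b x * d x * d_one E \<xi> V V' x"
    if "is_section E U" "is_section E V" "is_section E U'" "is_section E V'" "one_form E \<xi>"
      "smooth_fun E a" "smooth_fun E b" "smooth_fun E c" "smooth_fun E d"
    for a b c d U V U' V' \<xi>
    using that
    by (simp add: d_one_diff_left d_one_diff_right d_one_scale_left d_one_scale_right
        section_scale section_diff algebra_simps)
  have B: "\<xi> x (bracket E V U x) = - \<xi> x (bracket E U V x)"
    if "is_section E U" "is_section E V" "one_form E \<xi>" for U V \<xi>
    using bracket_skew[OF that(2,1), of x]
      dual_minus[OF one_form_dual[OF that(3)] section_fibre[OF bracket_section[OF that(1,2)]], of x] by simp
  note B' = B[OF X Z] B[OF X W] B[OF Y Z] B[OF Y W]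
  show ?thesis
    unfolding schouten_def Let_def sharp_wedge_two[OF X Y] sharp_wedge_two[OF Z W]
    by (simp only: A D sec \<alpha> \<beta> \<gamma> sm insert_iff simp_thms,
        simp only: d_one_def B' \<alpha> \<beta> \<gamma> wedge_three_def wedge_two_def, algebra)
qed

end

end

theory Submission
  imports Defs
begin

text \<open>
  If \<open>\<omega>\<close> has inverse \<open>\<pi>\<close>, then with \<open>X = \<pi>\<^sup>\<sharp>\<alpha>\<close>, \<open>Y = \<pi>\<^sup>\<sharp>\<beta>\<close>, \<open>Z = \<pi>\<^sup>\<sharp>\<gamma>\<close> one has
  \<open>[\<pi>, \<pi>](\<alpha>, \<beta>, \<gamma>) = 2 d\<omega>(X, Y, Z)\<close>, so the inverse of a symplectic form is Poisson.
  For \<open>i \<noteq> j\<close> the endomorphism \<open>N = \<pi>\<^sub>j\<^sup>\<sharp> \<circ> \<omega>\<^sub>i\<^sup>\<flat>\<close> is a transition tensor or the inverse of one, so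
  \<open>N\<^sup>2 = \<epsilon> Id\<close> with \<open>\<epsilon> = \<plusminus>1\<close>. Applying \<open>\<omega>\<^sub>j\<^sup>\<flat>\<close> to this identity gives
  \<open>\<omega>\<^sub>i\<^sup>\<flat> \<circ> N = \<epsilon> \<omega>\<^sub>j\<^sup>\<flat>\<close>, and \<open>\<epsilon> \<omega>\<^sub>j\<close> is closed.
\<close>

context vbundle
begin

lemma two_form_simps:
  assumes "two_form E \<omega>" "u \<in> fibre E x" "v \<in> fibre E x"
  shows "w \<in> fibre E x \<Longrightarrow> \<omega> x (u + v) w = \<omega> x u w + \<omega> x v w"
    and "\<omega> x (c *\<^sub>R u) v = c * \<omega> x u v"
    and "\<omega> x u v = - \<omega> x v u"
  using assms unfolding two_form_def by blast+

lemma flat_dual: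
  assumes \<omega>: "two_form E \<omega>" and u: "u \<in> fibre E x"
  shows "flat E \<omega> x u \<in> dual_fibre E x"
proof -
  \<comment> \<open>\<open>two_form\<close> gives linearity in the first slot; antisymmetry carries
    it to the second.\<close>
  have "\<omega> x u (v + w) = \<omega> x u v + \<omega> x u w" if "v \<in> fibre E x" "w \<in> fibre E x" for v w
    using two_form_simps(1)[OF \<omega> that u] that u
    by (simp add: two_form_simps(3)[OF \<omega> u])
  moreover have "\<omega> x u (c *\<^sub>R v) = c * \<omega> x u v" if "v \<in> fibre E x" for v c
    using two_form_simps(2)[OF \<omega> that u] that u
    by (simp add: two_form_simps(3)[OF \<omega> u])
  ultimately show ?thesis by (simp add: dual_fibre_def flat_def)
qed

lemma flat_scale:
  assumes "two_form E \<omega>" "u \<in> fibre E x"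
  shows "flat E \<omega> x (c *\<^sub>R u) = (\<lambda>v. c * flat E \<omega> x u v)"
  using two_form_simps(2)[OF assms] by (auto simp: flat_def)

lemma sharp_scale:
  assumes "bivector E P" "\<alpha> \<in> dual_fibre E x"
  shows "sharp E P x (\<lambda>v. c * \<alpha> v) = c *\<^sub>R sharp E P x \<alpha>"
  by (rule sharp_unique)
     (simp_all add: sharp[OF assms] dual_simps(2) bivector_simps(2)[OF assms])

lemma sharp_flat_fibre:
  assumes "bivector E P" "two_form E \<omega>" "u \<in> fibre E x"
  shows "sharp_flat E P \<omega> x u \<in> fibre E x"
  unfolding sharp_flat_def by (intro sharp(1) flat_dual assms)

lemma sharp_flat_scale:
  assumes "bivector E P" "two_form E \<omega>" "u \<in> fibre E x"
  shows "sharp_flat E P \<omega> x (c *\<^sub>R u) = c *\<^sub>R sharp_flat E P \<omega> x u"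
  unfolding sharp_flat_def flat_scale[OF assms(2,3)]
  by (rule sharp_scale[OF assms(1) flat_dual[OF assms(2,3)]])

lemma inverse_bivectorD:
  assumes "inverse_bivector E \<omega> P"
  shows "bivector E P"
    and "\<alpha> \<in> dual_fibre E x \<Longrightarrow> flat E \<omega> x (sharp E P x \<alpha>) = \<alpha>"
    and "u \<in> fibre E x \<Longrightarrow> sharp E P x (flat E \<omega> x u) = u"
  using assms by (auto simp: inverse_bivector_def)

text \<open>The inner \<open>flat E \<omega>\<close> and \<open>sharp E P\<close> cancel, leaving
  \<open>sharp E P'\<close> after \<open>flat E \<omega>'\<close>, which cancel in turn.\<close>

lemma sharp_flat_inverse:
  assumes "two_form E \<omega>" "two_form E \<omega>'" "inverse_bivector E \<omega> P" "inverse_bivector E \<omega>' P'"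
    and "u \<in> fibre E x"
  shows "sharp_flat E P' \<omega> x (sharp_flat E P \<omega>' x u) = u"
  using assms by (simp add: sharp_flat_def inverse_bivectorD flat_dual)

text \<open>The two composites are inverse to each other, so the square of one is
  \<open>1 / c\<close> times the identity, and \<open>1 / c = c\<close> because \<open>c\<close> is
  a sign.\<close>

lemma sharp_flat_square_inverse:
  assumes \<omega>: "two_form E \<omega>" and \<omega>': "two_form E \<omega>'"
    and P: "inverse_bivector E \<omega> P" and P': "inverse_bivector E \<omega>' P'"
    and c: "c = 1 \<or> c = -1"
    and sq: "\<And>u. u \<in> fibre E x \<Longrightarrow> sharp_flat E P \<omega>' x (sharp_flat E P \<omega>' x u) = c *\<^sub>R u"
    and u: "u \<in> fibre E x"
  shows "sharp_flat E P' \<omega> x (sharp_flat E P' \<omega> x u) = c *\<^sub>R u"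
proof -
  let ?M = "sharp_flat E P \<omega>' x" and ?N = "sharp_flat E P' \<omega> x"
  note bi = inverse_bivectorD(1)[OF P] inverse_bivectorD(1)[OF P']
  have "?N (?N (?M (?M u))) = u"
    using sharp_flat_inverse[OF \<omega> \<omega>' P P'] sharp_flat_fibre[OF bi(1) \<omega>'] u by simp
  then have "c *\<^sub>R ?N (?N u) = u"
    using sq[OF u] u by (simp add: sharp_flat_scale[OF bi(2) \<omega>] sharp_flat_fibre[OF bi(2) \<omega>])
  then have "c *\<^sub>R c *\<^sub>R ?N (?N u) = c *\<^sub>R u" by simp
  then show ?thesis using c by auto
qed

lemma deformed_two_form_eq:
  assumes \<omega>: "two_form E \<omega>" and \<omega>': "two_form E \<omega>'" and P': "inverse_bivector E \<omega>' P'"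
    and sq: "\<And>u. u \<in> fibre E x \<Longrightarrow> sharp_flat E P' \<omega> x (sharp_flat E P' \<omega> x u) = c *\<^sub>R u"
    and u: "u \<in> fibre E x" and v: "v \<in> fibre E x"
  shows "\<omega> x (sharp_flat E P' \<omega> x u) v = c * \<omega>' x u v"
proof -
  let ?N = "sharp_flat E P' \<omega> x"
  have N: "?N u \<in> fibre E x" by (rule sharp_flat_fibre[OF inverse_bivectorD(1)[OF P'] \<omega> u])
  \<comment> \<open>On covectors \<open>flat E \<omega>'\<close> after \<open>sharp E P'\<close> is
    the identity; inserting it in front of \<open>flat E \<omega>\<close> produces a second factor
    \<open>?N\<close>.\<close>
  have "flat E \<omega> x (?N u) = flat E \<omega>' x (?N (?N u))"
    using inverse_bivectorD(2)[OF P' flat_dual[OF \<omega> N]] by (simp add: sharp_flat_def)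
  also have "\<dots> = (\<lambda>v. c * flat E \<omega>' x u v)"
    by (simp add: sq[OF u] flat_scale[OF \<omega>' u])
  finally show ?thesis using v by (simp add: flat_def fun_eq_iff split: if_splits)
qed

text \<open>Reduces smoothness of \<open>\<omega> x (X x) (Y x)\<close> to that of a one-form paired
  with a section.\<close>

lemma flat_section:
  assumes \<omega>: "two_form E \<omega>" and X: "is_section E X"
  shows "one_form E (\<lambda>x. flat E \<omega> x (X x))"
proof -
  have "smooth_fun_on E U (\<lambda>x. flat E \<omega> x (X x) (e a x))"
    if U: "(U, e) \<in> frames E" and a: "a < rank_bundle E" for U e a
  proof (rule smooth_fun_on_cong[OF manifold frame(1)[OF U]])
    fix x assume x: "x \<in> U"
    note ea = frame_in_fibre[OF U x a]
    have "\<omega> x (e a x) (X x) = (\<Sum>b<rank_bundle E. \<omega> x (e a x) (e b x) * coframe E e x b (X x))"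
      using fun_cong[OF dual_expand[OF U x flat_dual[OF \<omega> ea]], of "X x"]
      by (simp add: flat_def section_fibre[OF X] frame_in_fibre[OF U x])
    \<comment> \<open>\<open>dual_expand\<close> is applied to the covector of \<open>e a x\<close>,
      so \<open>X\<close> sits in the second slot; swapping the slots costs the sign.\<close>
    then show "- (\<Sum>b<rank_bundle E. \<omega> x (e a x) (e b x) * coframe E e x b (X x)) =
        flat E \<omega> x (X x) (e a x)"
      using two_form_simps(3)[OF \<omega> ea section_fibre[OF X]] by (simp add: flat_def ea)
  next
    have "smooth_fun_on E U (\<lambda>x. \<omega> x (e a x) (e b x))" if "b < rank_bundle E" for b
      using bspec[OF conjunct2[OF \<omega>[unfolded two_form_def]] U] a that by simp
    then show "smooth_fun_on E U
        (\<lambda>x. - (\<Sum>b<rank_bundle E. \<omega> x (e a x) (e b x) * coframe E e x b (X x)))"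
      by (intro smooth_fun_on_minus smooth_fun_on_sum smooth_fun_on_mult section_smooth[OF X U]) simp_all
  qed
  then show ?thesis
    by (auto simp: one_form_def intro: flat_dual[OF \<omega> section_fibre[OF X]])
qed

lemma smooth_two_form:
  assumes "two_form E \<omega>" "is_section E X" "is_section E Y"
  shows "smooth_fun E (\<lambda>x. \<omega> x (X x) (Y x))"
  using smooth_pairing[OF flat_section[OF assms(1,2)] assms(3)]
  by (simp add: flat_def section_fibre[OF assms(3)])

text \<open>The relation between the deformed form and a multiple of \<open>\<omega>'\<close> is
  known on fibre vectors only, so it cannot be used as an equality of functions on the whole ambient
  space.\<close>

lemma two_form_scale_cong:
  assumes \<omega>: "two_form E \<omega>"
    and eq: "\<And>x u v. u \<in> fibre E x \<Longrightarrow> v \<in> fibre E x \<Longrightarrow> \<eta> x u v = c * \<omega> x u v"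
  shows "two_form E \<eta>"
proof -
  have "smooth_fun_on E U (\<lambda>x. \<eta> x (e a x) (e b x))"
    if U: "(U, e) \<in> frames E" and ab: "a < rank_bundle E" "b < rank_bundle E" for U e a b
  proof (rule smooth_fun_on_cong[OF manifold frame(1)[OF U]])
    show "c * \<omega> x (e a x) (e b x) = \<eta> x (e a x) (e b x)" if "x \<in> U" for x
      using eq frame_in_fibre[OF U that] ab by simp
    have "smooth_fun_on E U (\<lambda>x. \<omega> x (e a x) (e b x))"
      using bspec[OF conjunct2[OF \<omega>[unfolded two_form_def]] U] ab by simp
    then show "smooth_fun_on E U (\<lambda>x. c * \<omega> x (e a x) (e b x))"
      by (rule smooth_fun_on_mult[OF smooth_fun_on_const])
  qed
  moreover have "\<eta> x (u + v) w = \<eta> x u w + \<eta> x v w \<and> \<eta> x (r *\<^sub>R u) w = r * \<eta> x u w \<and>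
      \<eta> x u w = - \<eta> x w u"
    if "u \<in> fibre E x" "v \<in> fibre E x" "w \<in> fibre E x" for x u v w r
    using that two_form_simps(1,2)[OF \<omega>] two_form_simps(3)[OF \<omega> that(1,3)]
    by (simp add: eq algebra_simps)
  ultimately show ?thesis unfolding two_form_def by blast
qed

end

context lalgebroid
begin

lemma d_two_scale_cong:
  assumes \<omega>: "two_form E \<omega>"
    and eq: "\<And>x u v. u \<in> fibre E x \<Longrightarrow> v \<in> fibre E x \<Longrightarrow> \<eta> x u v = c * \<omega> x u v"
    and sec: "is_section E X" "is_section E Y" "is_section E Z"
  shows "d_two E \<eta> X Y Z x = c * d_two E \<omega> X Y Z x"
proof -
  \<comment> \<open>The anchor is known to be linear on smooth functions only, hence the appeal to
    \<open>smooth_two_form\<close>.\<close>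
  have a: "anchor E x u (\<lambda>y. c * \<omega> y (V y) (W y)) = c * anchor E x u (\<lambda>y. \<omega> y (V y) (W y))"
    if "u \<in> fibre E x" "is_section E V" "is_section E W" for u V W
    using that smooth_two_form[OF \<omega>] by (intro anchor_fun_scale) auto
  show ?thesis
    unfolding d_two_def
    by (simp add: eq section_fibre sec bracket_section a algebra_simps)
qed

lemma closed_two_form_scale_cong:
  assumes "closed_two_form E \<omega>"
    and "\<And>x u v. u \<in> fibre E x \<Longrightarrow> v \<in> fibre E x \<Longrightarrow> \<eta> x u v = c * \<omega> x u v"
  shows "closed_two_form E \<eta>"
  using assms two_form_scale_cong[of \<omega> \<eta> c] d_two_scale_cong[of \<omega> \<eta> c]
  by (simp add: closed_two_form_def)

text \<open>Writing each one-form as the contraction of \<open>\<omega>\<close> with its sharp turns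
  the bracket into derivatives and brackets of three sections. The factor 2 arises because both
  bivector arguments are \<open>P\<close>, so the terms of \<open>schouten\<close> coincide in
  pairs.\<close>

lemma schouten_inverse_bivector:
  assumes \<omega>: "two_form E \<omega>" and P: "inverse_bivector E \<omega> P"
    and forms: "one_form E \<alpha>" "one_form E \<beta>" "one_form E \<gamma>"
  shows "schouten E P P \<alpha> \<beta> \<gamma> x =
    2 * d_two E \<omega> (\<lambda>y. sharp E P y (\<alpha> y)) (\<lambda>y. sharp E P y (\<beta> y)) (\<lambda>y. sharp E P y (\<gamma> y)) x"
proof -
  note bi = inverse_bivectorD(1)[OF P]
  define S where "S \<xi> y = sharp E P y (\<xi> y)" for \<xi> y
  have sec: "is_section E (S \<xi>)" if "one_form E \<xi>" for \<xi>
    unfolding S_def using sharp_section[OF bi that] .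
  have form: "\<xi> y v = \<omega> y (S \<xi> y) v" if "one_form E \<xi>" "v \<in> fibre E y" for \<xi> y v
    using fun_cong[OF inverse_bivectorD(2)[OF P one_form_dual[OF that(1)]], of y v] that(2)
    by (simp add: flat_def S_def)
  \<comment> \<open>The arguments are swapped since \<open>P y (\<xi> y) (\<zeta> y)\<close> is
    \<open>\<zeta> y\<close> evaluated at \<open>S \<xi> y\<close>.\<close>
  have pair: "P y (\<xi> y) (\<zeta> y) = \<omega> y (S \<zeta> y) (S \<xi> y)" if "one_form E \<xi>" "one_form E \<zeta>" for \<xi> \<zeta> y
    using sharp(2)[OF bi one_form_dual[OF that(1)] one_form_dual[OF that(2)], of y]
      form[OF that(2) section_fibre[OF sec[OF that(1)]], of y] by (simp add: S_def)
  have anti: "anchor E x u (\<lambda>y. \<omega> y (V y) (W y)) = - anchor E x u (\<lambda>y. \<omega> y (W y) (V y))"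
    if "u \<in> fibre E x" "is_section E V" "is_section E W" for u V W
    using anchor_fun_scale[OF that(1) smooth_two_form[OF \<omega> that(3,2)] smooth_two_form[OF \<omega> that(3,2)], of "-1"]
      two_form_simps(3)[OF \<omega> section_fibre[OF that(2)] section_fibre[OF that(3)]] by simp
  \<comment> \<open>Half of one cyclic summand of \<open>schouten\<close>. In the cyclic sum each
    derivative of a value of \<open>\<omega>\<close> occurs three times up to sign, and two
    occurrences cancel.\<close>
  have T: "anchor E x (S \<xi> x) (\<lambda>y. P y (\<eta> y) (\<zeta> y)) - d_one E \<xi> (S \<eta>) (S \<zeta>) x =
      - anchor E x (S \<xi> x) (\<lambda>y. \<omega> y (S \<eta> y) (S \<zeta> y)) - anchor E x (S \<eta> x) (\<lambda>y. \<omega> y (S \<xi> y) (S \<zeta> y)) +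
      anchor E x (S \<zeta> x) (\<lambda>y. \<omega> y (S \<xi> y) (S \<eta> y)) - \<omega> x (bracket E (S \<eta>) (S \<zeta>) x) (S \<xi> x)"
    if f: "one_form E \<xi>" "one_form E \<eta>" "one_form E \<zeta>" for \<xi> \<eta> \<zeta>
  proof -
    note s = sec[OF f(1)] sec[OF f(2)] sec[OF f(3)]
    show ?thesis
      unfolding d_one_def
      using anti[OF section_fibre[OF s(1)] s(3,2)]
        two_form_simps(3)[OF \<omega> section_fibre[OF s(1)] section_fibre[OF bracket_section[OF s(2,3)]], of x]
      by (simp add: pair f form[OF f(1)] section_fibre s bracket_section)
  qed
  \<comment> \<open>The cyclic sum contains the bracket of the third section with the first, whereas
    \<open>d_two\<close> has it in the opposite order.\<close>
  have br: "\<omega> x (bracket E V W x) u = - \<omega> x (bracket E W V x) u"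
    if "is_section E V" "is_section E W" "u \<in> fibre E x" for V W u
    using bracket_skew[OF that(1,2), of x] that
      two_form_simps(2)[OF \<omega> section_fibre[OF bracket_section[OF that(2,1)]] that(3), of "-1"] by simp
  note s = sec[OF forms(1)] sec[OF forms(2)] sec[OF forms(3)]
  show ?thesis
    unfolding schouten_def Let_def S_def[symmetric] S_def[abs_def, symmetric] d_two_def
    using T[OF forms] T[OF forms(2,3,1)] T[OF forms(3,1,2)]
      anti[OF section_fibre[OF s(1)] s(3,2)] anti[OF section_fibre[OF s(2)] s(3,1)]
      anti[OF section_fibre[OF s(3)] s(2,1)] br[OF s(3,1) section_fibre[OF s(2)]]
    by simp
qed

lemma inverse_bivector_poisson:
  assumes "closed_two_form E \<omega>" "inverse_bivector E \<omega> P"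
  shows "poisson_bivector E P"
  using assms schouten_inverse_bivector[of \<omega> P] sharp_section[of P] inverse_bivectorD(1)[of \<omega> P]
  by (simp add: poisson_bivector_def closed_two_form_def)

text \<open>The common criterion for both halves of the theorem, which then only have to supply the
  square of the composite.\<close>

lemma P_Omega_of_square:
  assumes \<omega>: "closed_two_form E \<omega>" and \<omega>': "closed_two_form E \<omega>'" and P': "inverse_bivector E \<omega>' P'"
    and sq: "\<And>x u. u \<in> fibre E x \<Longrightarrow> sharp_flat E P' \<omega> x (sharp_flat E P' \<omega> x u) = c *\<^sub>R u"
  shows "P_Omega E P' \<omega>"
proof -
  have "two_form E \<omega>" "two_form E \<omega>'" using \<omega> \<omega>' by (simp_all add: closed_two_form_def)
  note eq = deformed_two_form_eq[OF this P' sq]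
  show ?thesis
    unfolding P_Omega_def
    by (intro conjI inverse_bivector_poisson[OF \<omega>' P'] \<omega> closed_two_form_scale_cong[OF \<omega>' eq])
qed

end

theorem proposition4p1:
  fixes E :: "('m :: {t2_space, second_countable_topology}, 'v :: real_vector) algebroid"
    and \<epsilon> :: "3 \<Rightarrow> real"
    and \<omega> :: "3 \<Rightarrow> 'm \<Rightarrow> 'v \<Rightarrow> 'v \<Rightarrow> real"
    and \<pi> :: "3 \<Rightarrow> 'm \<Rightarrow> ('v \<Rightarrow> real) \<Rightarrow> ('v \<Rightarrow> real) \<Rightarrow> real"
  assumes "lie_algebroid E"
    and "hypersymplectic E \<epsilon> \<omega> \<pi>"
  shows "(\<forall>i. P_Omega E (\<pi> (i + 1)) (\<omega> i)) \<and>
         (\<forall>i. P_Omega E (\<pi> (i - 1)) (\<omega> i))"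
proof -
  interpret lalgebroid E by unfold_locales (rule assms(1))
  have \<epsilon>: "\<epsilon> i = 1 \<or> \<epsilon> i = -1" and closed: "closed_two_form E (\<omega> i)"
    and inv: "inverse_bivector E (\<omega> i) (\<pi> i)"
    and N: "u \<in> fibre E x \<Longrightarrow>
      transition_tensor E \<omega> \<pi> i x (transition_tensor E \<omega> \<pi> i x u) = \<epsilon> i *\<^sub>R u" for i x u
    using assms(2) by (simp_all add: hypersymplectic_def symplectic_form_def)
  have form: "two_form E (\<omega> i)" for i using closed by (simp add: closed_two_form_def)
  have three: "(3 :: 3) = 0" by simp
  have idx: "i - 1 - 1 = i + 1" "i + 1 + 1 = i - 1" for i :: 3
    using three by (simp_all add: algebra_simps)
  \<comment> \<open>This composite is the transition tensor of index \<open>i - 1\<close>, because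
    \<open>i - 2 = i + 1\<close> modulo three.\<close>
  have a: "sharp_flat E (\<pi> (i + 1)) (\<omega> i) x (sharp_flat E (\<pi> (i + 1)) (\<omega> i) x u) = \<epsilon> (i - 1) *\<^sub>R u"
    if "u \<in> fibre E x" for i x u
    using N[OF that, of "i - 1"] by (simp add: transition_tensor_def idx)
  \<comment> \<open>The transition tensor of index \<open>i + 1\<close> is the inverse of the
    composite needed for \<open>\<pi> (i - 1)\<close> and \<open>\<omega> i\<close>, so its square
    is transferred by \<open>sharp_flat_square_inverse\<close>.\<close>
  have "sharp_flat E (\<pi> i) (\<omega> (i - 1)) x (sharp_flat E (\<pi> i) (\<omega> (i - 1)) x u) = \<epsilon> (i + 1) *\<^sub>R u"
    if "u \<in> fibre E x" for i x u
    using N[OF that, of "i + 1"] by (simp add: transition_tensor_def idx)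
  then have b: "sharp_flat E (\<pi> (i - 1)) (\<omega> i) x (sharp_flat E (\<pi> (i - 1)) (\<omega> i) x u) = \<epsilon> (i + 1) *\<^sub>R u"
    if "u \<in> fibre E x" for i x u
    using sharp_flat_square_inverse[OF form form inv inv \<epsilon> _ that] by blast
  show ?thesis
    using P_Omega_of_square[OF closed closed inv a] P_Omega_of_square[OF closed closed inv b] by blast
qed

end
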